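(* Let $\{A_i\}_{i=1}^n$ be a set of Pauli strings whose frustration graph is $G$. Then for any state $\rho$ and any real coefficients $a_1,\dots,a_n$, $$\Big(\sum_ia_i\langle A_i\rangle_\rho\Big)^2\le\inf_w\Big(\sum_i\frac{a_i^2}{w_i}\Big)\beta(G,w)\le\inf_w\Big(\sum_i\frac{a_i^2}{w_i}\Big)\vartheta(G,w),$$ where the infima are over weight vectors $w=(w_1,\dots,w_n)$ with all $w_i>0$.
   Context: A Pauli string is a tensor product of finitely many of the matrices $\mathbb{I},X,Y,Z$; all $A_i$ act on the same qubits. The frustration graph of $\{A_i\}$ is the graph on $\{1,\dots,n\}$ in which $i\ne j$ are adjacent iff $A_i$ and $A_j$ anti-commute (otherwise they commute). A state is a density operator $\rho$ and $\langle A\rangle_\rho=\operatorname{Tr}(\rho A)$. The weighted beta number is $\beta(G,w)=\sup\sum_iw_i\langle S_i\rangle_\rho^2$ over all self-adjoint unitary representations $\{S_i\}$ of $G$ (families of self-adjoint $S_i$ on some Hilbert space with $S_i^2=\mathbb{I}$, anti-commuting for adjacent and commuting for non-adjacent vertices) and all density operators $\rho$. The weighted Lovász number is $\vartheta(G,w)=\max\sum_iw_i|\langle\phi_0|v_i\rangle|^2$ over unit vectors $\phi_0,v_1,\dots,v_n$ in a real Euclidean space of arbitrary finite dimension with $\langle v_i|v_j\rangle=0$ for adjacent $i,j$. *)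

theory Defs
  imports
    "HOL-Analysis.Infinite_Sum"
    "HOL-Library.Infinite_Typeclass"
    "Jordan_Normal_Form.Matrix"
begin

section \<open>Pauli strings, density matrices and frustration graphs\<close>

definition pauli_X :: "complex mat" where
  "pauli_X = mat_of_rows_list 2 [[0, 1], [1, 0]]"

definition pauli_Y :: "complex mat" where
  "pauli_Y = mat_of_rows_list 2 [[0, - \<i>], [\<i>, 0]]"

definition pauli_Z :: "complex mat" where
  "pauli_Z = mat_of_rows_list 2 [[1, 0], [0, - 1]]"

definition kronecker :: "'a::semiring_1 mat \<Rightarrow> 'a mat \<Rightarrow> 'a mat" where
  "kronecker A B =
     mat (dim_row A * dim_row B) (dim_col A * dim_col B)
       (\<lambda>(i, j). A $$ (i div dim_row B, j div dim_col B) * B $$ (i mod dim_row B, j mod dim_col B))"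

definition pauli_string :: "nat \<Rightarrow> complex mat \<Rightarrow> bool" where
  "pauli_string m M \<longleftrightarrow>
     (\<exists>Ps. length Ps = m \<and> set Ps \<subseteq> {1\<^sub>m 2, pauli_X, pauli_Y, pauli_Z} \<and>
           M = foldr kronecker Ps (1\<^sub>m 1))"

definition mat_trace :: "'a::comm_monoid_add mat \<Rightarrow> 'a" where
  "mat_trace M = (\<Sum>i<dim_row M. M $$ (i, i))"

definition nonneg_complex :: "complex \<Rightarrow> bool" where
  "nonneg_complex z \<longleftrightarrow> Im z = 0 \<and> 0 \<le> Re z"

definition density_matrix :: "nat \<Rightarrow> complex mat \<Rightarrow> bool" where
  "density_matrix d \<rho> \<longleftrightarrow>
     \<rho> \<in> carrier_mat d d \<and>
     (\<forall>v\<in>carrier_vec d. nonneg_complex ((\<rho> *\<^sub>v v) \<bullet>c v)) \<and>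
     mat_trace \<rho> = 1"

text \<open>The trace below is real whenever \<open>A\<close> is Hermitian, in particular for Pauli strings; the real
  part only serves to obtain the type \<open>real\<close>.\<close>

definition mat_expectation :: "complex mat \<Rightarrow> complex mat \<Rightarrow> real" where
  "mat_expectation \<rho> A = Re (mat_trace (\<rho> * A))"

text \<open>A finite simple graph is a pair of a vertex set and a set of two-element edges.\<close>

type_synonym 'v ugraph = "'v set \<times> 'v set set"

abbreviation verts :: "'v ugraph \<Rightarrow> 'v set" where
  "verts G \<equiv> fst G"

abbreviation edges :: "'v ugraph \<Rightarrow> 'v set set" where
  "edges G \<equiv> snd G"

definition frustration_graph :: "nat \<Rightarrow> (nat \<Rightarrow> complex mat) \<Rightarrow> nat ugraph" where
  "frustration_graph n A =
     ({1..n}, {{i, j} | i j. i \<in> {1..n} \<and> j \<in> {1..n} \<and> i \<noteq> j \<and> A i * A j = - (A j * A i)})"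

section \<open>Hilbert spaces and the weighted beta number\<close>

text \<open>Every complex Hilbert space has an orthonormal basis and is therefore, up to unitary
  isomorphism, the space of square-summable families indexed by some set \<open>I\<close>. Neither finite
  dimension nor separability is imposed. Vectors are extended by zero outside \<open>I\<close>, and
  the inner product is antilinear in its first argument. Operators are functions
  of which only the values on \<open>ell2 I\<close> matter.\<close>

definition ell2 :: "'u set \<Rightarrow> ('u \<Rightarrow> complex) set" where
  "ell2 I = {x. (\<forall>i. i \<notin> I \<longrightarrow> x i = 0) \<and> (\<lambda>i. (cmod (x i))\<^sup>2) summable_on I}"

definition ell2_inner :: "'u set \<Rightarrow> ('u \<Rightarrow> complex) \<Rightarrow> ('u \<Rightarrow> complex) \<Rightarrow> complex" where
  "ell2_inner I x y = (\<Sum>\<^sub>\<infinity>i\<in>I. cnj (x i) * y i)"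

definition ell2_norm :: "'u set \<Rightarrow> ('u \<Rightarrow> complex) \<Rightarrow> real" where
  "ell2_norm I x = sqrt (\<Sum>\<^sub>\<infinity>i\<in>I. (cmod (x i))\<^sup>2)"

definition ell2_basis :: "'u \<Rightarrow> 'u \<Rightarrow> complex" where
  "ell2_basis i = (\<lambda>j. if j = i then 1 else 0)"

type_synonym 'u operator = "('u \<Rightarrow> complex) \<Rightarrow> ('u \<Rightarrow> complex)"

definition bounded_operator :: "'u set \<Rightarrow> 'u operator \<Rightarrow> bool" where
  "bounded_operator I T \<longleftrightarrow>
     (\<forall>x\<in>ell2 I. T x \<in> ell2 I) \<and>
     (\<forall>x\<in>ell2 I. \<forall>y\<in>ell2 I. T (\<lambda>i. x i + y i) = (\<lambda>i. T x i + T y i)) \<and>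
     (\<forall>c. \<forall>x\<in>ell2 I. T (\<lambda>i. c * x i) = (\<lambda>i. c * T x i)) \<and>
     (\<exists>B. \<forall>x\<in>ell2 I. ell2_norm I (T x) \<le> B * ell2_norm I x)"

definition self_adjoint :: "'u set \<Rightarrow> 'u operator \<Rightarrow> bool" where
  "self_adjoint I T \<longleftrightarrow>
     bounded_operator I T \<and>
     (\<forall>x\<in>ell2 I. \<forall>y\<in>ell2 I. ell2_inner I (T x) y = ell2_inner I x (T y))"

text \<open>For a positive operator, summability of the diagonal in one orthonormal basis is the same as
  being trace class. For such \<open>\<rho>\<close> the diagonal of \<open>\<rho> A\<close> is absolutely summable for every bounded
  \<open>A\<close>, so the infinite sum in \<open>expectation\<close> is a genuine trace; it is real for self-adjoint \<open>A\<close>.\<close>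

definition density_operator :: "'u set \<Rightarrow> 'u operator \<Rightarrow> bool" where
  "density_operator I \<rho> \<longleftrightarrow>
     bounded_operator I \<rho> \<and>
     (\<forall>x\<in>ell2 I. nonneg_complex (ell2_inner I x (\<rho> x))) \<and>
     ((\<lambda>i. ell2_inner I (ell2_basis i) (\<rho> (ell2_basis i))) has_sum 1) I"

definition expectation :: "'u set \<Rightarrow> 'u operator \<Rightarrow> 'u operator \<Rightarrow> real" where
  "expectation I \<rho> A = Re (\<Sum>\<^sub>\<infinity>i\<in>I. ell2_inner I (ell2_basis i) (\<rho> (A (ell2_basis i))))"

definition self_adjoint_unitary_rep ::
    "'v ugraph \<Rightarrow> 'u set \<Rightarrow> ('v \<Rightarrow> 'u operator) \<Rightarrow> bool" where
  "self_adjoint_unitary_rep G I S \<longleftrightarrow>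
     (\<forall>i\<in>verts G. self_adjoint I (S i) \<and> (\<forall>x\<in>ell2 I. S i (S i x) = x)) \<and>
     (\<forall>i\<in>verts G. \<forall>j\<in>verts G. i \<noteq> j \<longrightarrow>
        (if {i, j} \<in> edges G
         then \<forall>x\<in>ell2 I. S i (S j x) = (\<lambda>k. - S j (S i x) k)
         else \<forall>x\<in>ell2 I. S i (S j x) = S j (S i x)))"

text \<open>A supremum over all Hilbert spaces has to be taken inside some type: the index sets \<open>I\<close> range
  over the subsets of an arbitrary type \<open>'u\<close>, so a statement that is polymorphic in \<open>'u\<close> covers
  Hilbert spaces of every dimension. An infinite \<open>'u\<close> provides all finite-dimensional and all
  separable spaces. For nonnegative weights on a finite graph the supremum is
  over a nonempty set bounded by the sum of the weights.\<close>

definition weighted_beta :: "'u::infinite itself \<Rightarrow> 'v ugraph \<Rightarrow> ('v \<Rightarrow> real) \<Rightarrow> real" where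
  "weighted_beta _ G w =
     Sup {\<Sum>i\<in>verts G. w i * (expectation I \<rho> (S i))\<^sup>2 | (I :: 'u set) S \<rho>.
            self_adjoint_unitary_rep G I S \<and> density_operator I \<rho>}"

section \<open>The weighted Lovasz number\<close>

text \<open>The supremum ranges over all finite dimensions \<open>d\<close>. It is attained, hence a maximum, for
  nonnegative weights on a finite graph: \<open>card (verts G) + 1\<close> dimensions suffice, and the
  configurations in a fixed dimension form a compact set.\<close>

definition weighted_lovasz :: "'v ugraph \<Rightarrow> ('v \<Rightarrow> real) \<Rightarrow> real" where
  "weighted_lovasz G w =
     Sup {\<Sum>i\<in>verts G. w i * \<bar>\<phi> \<bullet> v i\<bar>\<^sup>2 | (d :: nat) (\<phi> :: real vec) (v :: 'v \<Rightarrow> real vec).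
            \<phi> \<in> carrier_vec d \<and> \<phi> \<bullet> \<phi> = 1 \<and>
            (\<forall>i\<in>verts G. v i \<in> carrier_vec d \<and> v i \<bullet> v i = 1) \<and>
            (\<forall>i\<in>verts G. \<forall>j\<in>verts G. {i, j} \<in> edges G \<longrightarrow> v i \<bullet> v j = 0)}"

end

theory Submission
  imports Defs "HOL-Analysis.Convex" "HOL-Analysis.L2_Norm"
begin

text \<open>The left inequality is a weighted Cauchy-Schwarz inequality, since the Pauli strings themselves are
  a self-adjoint unitary representation of their frustration graph.

  For the right one, \<open>(A, B) \<mapsto> tr (\<rho> A* B)\<close> is a positive form in which the identity and the \<open>S i\<close> are
  unit vectors and anti-commuting \<open>S i\<close>, \<open>S j\<close> have purely imaginary inner product, so the real
  part of their Gram matrix comes from a Lovasz configuration. In infinite dimension \<open>\<rho>\<close> is first cut down to finitely many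
  basis vectors, where a Cholesky factorization writes it as a mixture of vector states. A
  Cauchy-Schwarz estimate of the off-diagonal blocks of \<open>\<rho>\<close> shows that the expectations converge.\<close>

section \<open>Positive kernels\<close>

text \<open>A density operator is given only by positivity and a summable diagonal, so all that is
  used about it is drawn from its matrix entries. Cholesky elimination takes the place of a spectral
  decomposition: the terms of the mixture need be neither orthogonal nor normalised. The same
  factorization serves a second time, on the Gram matrix, to produce the Lovasz vectors.

  The obstacle in infinite dimension is that a partial sum of \<open>expectation\<close> over a
  finite set \<open>K\<close> is not the expectation in a cut-down state: it pairs the rows of
  \<rho> in \<open>K\<close> with all columns, while only the \<open>K\<close> by \<open>K\<close>
  corner is a finite mixture of vector states. The corner has trace \<open>t\<close> at most 1, so
  the Lovasz bound is proved in a homogeneous form with factor \<open>t\<^sup>2\<close>, and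
  \<open>t\<close> tends to 1 at the end.

  Suprema and infima are taken in the reals and need bounds: the Lovasz bound also shows that the
  set behind \<open>weighted_beta\<close> is bounded above, and the left inequality bounds the
  middle infimum from below.\<close>

definition pos_kernel :: "'a set \<Rightarrow> ('a \<Rightarrow> 'a \<Rightarrow> complex) \<Rightarrow> bool" where
  "pos_kernel F H \<longleftrightarrow>
     (\<forall>j\<in>F. \<forall>k\<in>F. H k j = cnj (H j k)) \<and>
     (\<forall>c. 0 \<le> Re (\<Sum>j\<in>F. \<Sum>k\<in>F. cnj (c j) * H j k * c k))"

text \<open>Symmetry is a separate clause of \<open>pos_kernel\<close> because the other one sees
  only the real part of the form, which an anti-Hermitian summand of \<open>H\<close> leaves
  unchanged.\<close>

lemma pos_kernel_sym: "pos_kernel F H \<Longrightarrow> j \<in> F \<Longrightarrow> k \<in> F \<Longrightarrow> H k j = cnj (H j k)"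
  unfolding pos_kernel_def by blast

lemma pos_kernel_nonneg:
  "pos_kernel F H \<Longrightarrow> 0 \<le> Re (\<Sum>j\<in>F. \<Sum>k\<in>F. cnj (c j) * H j k * c k)"
  unfolding pos_kernel_def by blast

lemma pos_kernel_subset:
  assumes "pos_kernel F H" "E \<subseteq> F" "finite F"
  shows "pos_kernel E H"
  unfolding pos_kernel_def
proof (intro conjI allI ballI)
  fix j k assume "j \<in> E" "k \<in> E"
  then show "H k j = cnj (H j k)" using assms pos_kernel_sym by (metis subsetD)
next
  fix c :: "'a \<Rightarrow> complex"
  define d where "d i = (if i \<in> E then c i else 0)" for i
  have "(\<Sum>j\<in>F. \<Sum>k\<in>F. cnj (d j) * H j k * d k) = (\<Sum>j\<in>E. \<Sum>k\<in>F. cnj (d j) * H j k * d k)"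
    by (rule sum.mono_neutral_right) (use assms in \<open>auto simp: d_def\<close>)
  also have "\<dots> = (\<Sum>j\<in>E. \<Sum>k\<in>E. cnj (d j) * H j k * d k)"
    by (rule sum.cong[OF refl], rule sum.mono_neutral_right) (use assms in \<open>auto simp: d_def\<close>)
  also have "\<dots> = (\<Sum>j\<in>E. \<Sum>k\<in>E. cnj (c j) * H j k * c k)"
    by (intro sum.cong refl) (auto simp: d_def)
  finally show "0 \<le> Re (\<Sum>j\<in>E. \<Sum>k\<in>E. cnj (c j) * H j k * c k)"
    using pos_kernel_nonneg[OF assms(1), of d] by simp
qed

lemma pos_kernel_diag:
  assumes "pos_kernel F H" "finite F" "a \<in> F"
  shows "0 \<le> Re (H a a)" "H a a = of_real (Re (H a a))"
proof -
  have "pos_kernel {a} H" using assms by (intro pos_kernel_subset[OF assms(1)]) auto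
  from pos_kernel_nonneg[OF this, of "\<lambda>_. 1"] show "0 \<le> Re (H a a)" by simp
  show "H a a = of_real (Re (H a a))"
    using pos_kernel_sym[OF assms(1,3,3)] by (simp add: complex_eq_iff)
qed

text \<open>On the indices \<open>a\<close>, \<open>k\<close> the form is affine in the coefficient
  at \<open>a\<close>, hence unbounded below unless \<open>H a k\<close> vanishes. This settles the
  zero pivots of the Cholesky elimination.\<close>

lemma pos_kernel_zero_diag:
  assumes "pos_kernel F H" "finite F" "a \<in> F" "k \<in> F" "H a a = 0"
  shows "H a k = 0"
proof (rule ccontr)
  assume nz: "H a k \<noteq> 0"
  then have "a \<noteq> k" using assms by auto
  \<comment> \<open>Solves \<open>Re (H k k) - 2 * t * (cmod (H a k))\<^sup>2 = - 1\<close>, the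
    left side being the form at the coefficients \<open>c\<close>.\<close>
  define t where "t = (Re (H k k) + 1) / (2 * (cmod (H a k))\<^sup>2)"
  define c where "c i = (if i = a then - of_real t * H a k else 1)" for i
  have "pos_kernel {a, k} H" using assms by (intro pos_kernel_subset[OF assms(1)]) auto
  from pos_kernel_nonneg[OF this, of c]
  have "0 \<le> Re (- of_real t * cnj (H a k) * H a k - H k a * (of_real t * H a k) + H k k)"
    using \<open>a \<noteq> k\<close> assms(5) by (simp add: c_def algebra_simps)
  also have "H k a = cnj (H a k)" using pos_kernel_sym assms by metis
  also have "Re (- of_real t * cnj (H a k) * H a k - cnj (H a k) * (of_real t * H a k) + H k k)
      = Re (H k k) - t * (2 * (cmod (H a k))\<^sup>2)"
    unfolding cmod_power2 by (simp add: power2_eq_square algebra_simps)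
  also have "\<dots> = - 1" using nz by (simp add: t_def)
  finally show False by simp
qed

text \<open>Cholesky decomposition: eliminating one index replaces the kernel by its Schur complement.\<close>

lemma pos_kernel_factor:
  assumes "finite F" "pos_kernel F H"
  shows "\<exists>\<psi> :: 'a \<Rightarrow> 'a \<Rightarrow> complex. \<forall>j\<in>F. \<forall>k\<in>F. H j k = (\<Sum>l\<in>F. \<psi> l j * cnj (\<psi> l k))"
  using assms
proof (induction F arbitrary: H rule: finite_induct)
  case empty
  then show ?case by simp
next
  case (insert a F)
  note fin = finite.insertI[OF insert.hyps(1), of a]
  define h where "h = Re (H a a)"
  have h: "H a a = of_real h" "0 \<le> h"
    using pos_kernel_diag[OF insert.prems fin, of a] by (auto simp: h_def)
  have sym: "\<And>j k. j \<in> insert a F \<Longrightarrow> k \<in> insert a F \<Longrightarrow> H k j = cnj (H j k)"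
    using pos_kernel_sym[OF insert.prems] .
  \<comment> \<open>For a zero pivot the quotient is 0 by convention and \<open>H'\<close> is
    \<open>H\<close>.\<close>
  define H' where "H' j k = H j k - H j a * H a k / of_real h" for j k
  have "pos_kernel F H'"
    unfolding pos_kernel_def
  proof (intro conjI allI ballI)
    fix j k assume "j \<in> F" "k \<in> F"
    then show "H' k j = cnj (H' j k)"
      unfolding H'_def using sym[of j k] sym[of a k] sym[of j a] by simp
  next
    fix c :: "'a \<Rightarrow> complex"
    define s where "s = (\<Sum>k\<in>F. H a k * c k)"
    have s': "(\<Sum>j\<in>F. cnj (c j) * H j a) = cnj s"
      unfolding s_def cnj_sum by (intro sum.cong refl) (use sym[of a] in auto)
    \<comment> \<open>The value at \<open>a\<close> completes the square in that coordinate. For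
      \<open>h = 0\<close> it is 0, and the form reduces to \<open>Q\<close>.\<close>
    define d where "d = c(a := - s / of_real h)"
    have da: "d a = - s / of_real h" and dF: "\<And>i. i \<in> F \<Longrightarrow> d i = c i"
      using insert.hyps by (auto simp: d_def)
    define Q where "Q = (\<Sum>j\<in>F. \<Sum>k\<in>F. cnj (c j) * H j k * c k)"
    have "(\<Sum>j\<in>insert a F. \<Sum>k\<in>insert a F. cnj (d j) * H j k * d k)
        = cnj (d a) * H a a * d a + cnj (d a) * (\<Sum>k\<in>F. H a k * c k)
          + (\<Sum>j\<in>F. cnj (c j) * H j a) * d a + Q"
      using insert.hyps
      by (simp add: dF Q_def sum.distrib sum_distrib_left sum_distrib_right mult.assoc cong: sum.cong)
    also have "\<dots> = Q - cnj s * s / of_real h"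
      unfolding s' s_def[symmetric] h(1) da by (cases "h = 0") (auto simp: field_simps)
    also have "\<dots> = (\<Sum>j\<in>F. \<Sum>k\<in>F. cnj (c j) * H' j k * c k)"
    proof -
      have "cnj s * s = (\<Sum>j\<in>F. \<Sum>k\<in>F. cnj (c j) * H j a * (H a k * c k))"
        by (simp only: s'[symmetric]) (simp only: s_def sum_product)
      then show ?thesis
        by (simp add: Q_def H'_def sum_divide_distrib sum_subtractf[symmetric] algebra_simps)
    qed
    finally show "0 \<le> Re (\<Sum>j\<in>F. \<Sum>k\<in>F. cnj (c j) * H' j k * c k)"
      using pos_kernel_nonneg[OF insert.prems, of d] by simp
  qed
  from insert.IH[OF this] obtain \<psi> where
    \<psi>: "\<forall>j\<in>F. \<forall>k\<in>F. H' j k = (\<Sum>l\<in>F. \<psi> l j * cnj (\<psi> l k))" by blast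
  \<comment> \<open>The eliminated index contributes column \<open>a\<close> of \<open>H\<close>,
    scaled by \<open>1 / sqrt h\<close>; the older factors are extended by zero at
    \<open>a\<close>.\<close>
  define \<chi> where
    "\<chi> l j = (if l = a then H j a / of_real (sqrt h) else if j = a then 0 else \<psi> l j)" for l j
  have sq: "of_real (sqrt h) * of_real (sqrt h) = (of_real h :: complex)"
    using h(2) by (metis of_real_mult real_sqrt_mult_self abs_of_nonneg)
  \<comment> \<open>With a zero pivot the new factor is 0, so row and column \<open>a\<close> of
    \<open>H\<close>, which only this factor represents, must vanish too.\<close>
  have zero: "h = 0 \<Longrightarrow> H a k = 0 \<and> H k a = 0" if "k \<in> insert a F" for k
    using pos_kernel_zero_diag[OF insert.prems fin, of a k] that h(1) sym[of a k] by auto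
  have head: "\<chi> a j * cnj (\<chi> a k) = H j a * H a k / of_real h"
    if "j \<in> insert a F" "k \<in> insert a F" for j k
    using sym[of a k] sym[of k a] that sq by (simp add: \<chi>_def)
  have "H j k = (\<Sum>l\<in>insert a F. \<chi> l j * cnj (\<chi> l k))"
    if jk: "j \<in> insert a F" "k \<in> insert a F" for j k
  proof (cases "j = a \<or> k = a")
    case True
    then have "(\<Sum>l\<in>F. \<chi> l j * cnj (\<chi> l k)) = 0"
      by (intro sum.neutral ballI) (use insert.hyps in \<open>auto simp: \<chi>_def\<close>)
    moreover have "H j a * H a k / of_real h = H j k"
      using True zero[OF jk(1)] zero[OF jk(2)] h(1) by (cases "h = 0") auto
    ultimately show ?thesis
      using insert.hyps head[OF jk] by simp
  next
    case False
    then have "j \<in> F" "k \<in> F" using jk by auto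
    have "(\<Sum>l\<in>F. \<chi> l j * cnj (\<chi> l k)) = (\<Sum>l\<in>F. \<psi> l j * cnj (\<psi> l k))"
      by (intro sum.cong refl) (use insert.hyps False in \<open>auto simp: \<chi>_def\<close>)
    also have "\<dots> = H' j k" using \<psi> \<open>j \<in> F\<close> \<open>k \<in> F\<close> by simp
    finally show ?thesis
      using insert.hyps head[OF jk] by (simp add: H'_def)
  qed
  then show ?case by blast
qed

section \<open>Square-summable families and density operators\<close>

lemma ell2_outside: "x \<in> ell2 I \<Longrightarrow> i \<notin> I \<Longrightarrow> x i = 0"
  by (simp add: ell2_def)

lemma ell2_square_summable: "x \<in> ell2 I \<Longrightarrow> (\<lambda>i. (cmod (x i))\<^sup>2) summable_on I"
  by (simp add: ell2_def)

lemma ell2_eqI: "x \<in> ell2 I \<Longrightarrow> y \<in> ell2 I \<Longrightarrow> (\<And>i. i \<in> I \<Longrightarrow> x i = y i) \<Longrightarrow> x = y"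
  by (rule ext) (metis ell2_outside)

lemma ell2_finite: "finite I \<Longrightarrow> x \<in> ell2 I \<longleftrightarrow> (\<forall>i. i \<notin> I \<longrightarrow> x i = 0)"
  by (simp add: ell2_def)

lemma ell2_add:
  assumes "x \<in> ell2 I" "y \<in> ell2 I"
  shows "(\<lambda>i. x i + y i) \<in> ell2 I"
proof -
  have "(\<lambda>i. 2 * (cmod (x i))\<^sup>2 + 2 * (cmod (y i))\<^sup>2) summable_on I"
    using assms by (intro summable_on_add summable_on_cmult_right ell2_square_summable)
  moreover have "(cmod (x i + y i))\<^sup>2 \<le> 2 * (cmod (x i))\<^sup>2 + 2 * (cmod (y i))\<^sup>2" for i
  proof -
    have "(cmod (x i + y i))\<^sup>2 \<le> (cmod (x i) + cmod (y i))\<^sup>2"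
      by (simp add: norm_triangle_ineq power_mono)
    also have "\<dots> \<le> 2 * (cmod (x i))\<^sup>2 + 2 * (cmod (y i))\<^sup>2"
      using sum_squares_bound[of "cmod (x i)" "cmod (y i)"] by (simp add: power2_sum)
    finally show ?thesis .
  qed
  ultimately have "(\<lambda>i. (cmod (x i + y i))\<^sup>2) summable_on I"
    by (rule summable_on_comparison_test) auto
  then show ?thesis using assms by (auto simp: ell2_def)
qed

lemma ell2_scale: "x \<in> ell2 I \<Longrightarrow> (\<lambda>i. c * x i) \<in> ell2 I"
  by (auto simp: ell2_def norm_mult power_mult_distrib intro: summable_on_cmult_right)

lemma ell2_zero: "(\<lambda>i. 0) \<in> ell2 I"
  by (simp add: ell2_def)

lemma ell2_sum: "(\<And>k. k \<in> F \<Longrightarrow> x k \<in> ell2 I) \<Longrightarrow> (\<lambda>i. \<Sum>k\<in>F. c k * x k i) \<in> ell2 I"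
  by (induction F rule: infinite_finite_induct) (simp_all add: ell2_add ell2_scale ell2_zero)

lemma ell2_basis_in: "k \<in> I \<Longrightarrow> ell2_basis k \<in> ell2 I"
proof -
  assume "k \<in> I"
  have "(\<lambda>i. (cmod (ell2_basis k i))\<^sup>2) summable_on I \<longleftrightarrow> (\<lambda>i. (cmod (ell2_basis k i))\<^sup>2) summable_on {k}"
    using \<open>k \<in> I\<close> by (intro summable_on_cong_neutral) (auto simp: ell2_basis_def)
  then show ?thesis using \<open>k \<in> I\<close> by (auto simp: ell2_def) (auto simp: ell2_basis_def)
qed

lemma ell2_inner_summable:
  assumes "x \<in> ell2 I" "y \<in> ell2 I"
  shows "(\<lambda>i. cnj (x i) * y i) summable_on I"
proof -
  have "(\<lambda>i. (cmod (x i))\<^sup>2 + (cmod (y i))\<^sup>2) summable_on I"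
    using assms by (intro summable_on_add ell2_square_summable)
  then have "(\<lambda>i. norm (cnj (x i) * y i)) summable_on I"
  proof (rule summable_on_comparison_test)
    fix i
    have "2 * (cmod (x i) * cmod (y i)) \<le> (cmod (x i))\<^sup>2 + (cmod (y i))\<^sup>2"
      using sum_squares_bound[of "cmod (x i)" "cmod (y i)"] by simp
    moreover have "0 \<le> cmod (x i) * cmod (y i)" by simp
    ultimately show "norm (cnj (x i) * y i) \<le> (cmod (x i))\<^sup>2 + (cmod (y i))\<^sup>2"
      unfolding norm_mult complex_mod_cnj by linarith
  qed auto
  then show ?thesis by (rule abs_summable_summable)
qed

lemma ell2_inner_has_sum:
  "x \<in> ell2 I \<Longrightarrow> y \<in> ell2 I \<Longrightarrow> ((\<lambda>i. cnj (x i) * y i) has_sum ell2_inner I x y) I"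
  unfolding ell2_inner_def by (intro has_sum_infsum ell2_inner_summable)

lemma ell2_inner_commute: "ell2_inner I y x = cnj (ell2_inner I x y)"
  unfolding ell2_inner_def infsum_cnj[symmetric] by (simp add: mult.commute)

lemma ell2_inner_add_right:
  "x \<in> ell2 I \<Longrightarrow> y \<in> ell2 I \<Longrightarrow> z \<in> ell2 I \<Longrightarrow>
    ell2_inner I x (\<lambda>i. y i + z i) = ell2_inner I x y + ell2_inner I x z"
  unfolding ell2_inner_def by (simp add: distrib_left infsum_add ell2_inner_summable)

lemma ell2_inner_scale_right: "ell2_inner I x (\<lambda>i. c * y i) = c * ell2_inner I x y"
  unfolding ell2_inner_def infsum_cmult_right'[symmetric] by (simp add: mult.left_commute)

lemma ell2_inner_add_left:
  "x \<in> ell2 I \<Longrightarrow> y \<in> ell2 I \<Longrightarrow> z \<in> ell2 I \<Longrightarrow>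
    ell2_inner I (\<lambda>i. x i + y i) z = ell2_inner I x z + ell2_inner I y z"
  by (subst (1 2 3) ell2_inner_commute) (simp add: ell2_inner_add_right)

lemma ell2_inner_scale_left: "ell2_inner I (\<lambda>i. c * x i) y = cnj c * ell2_inner I x y"
  by (subst (1 2) ell2_inner_commute) (simp add: ell2_inner_scale_right)

lemma ell2_inner_sum_right:
  assumes "x \<in> ell2 I" "\<And>k. k \<in> F \<Longrightarrow> y k \<in> ell2 I"
  shows "ell2_inner I x (\<lambda>i. \<Sum>k\<in>F. c k * y k i) = (\<Sum>k\<in>F. c k * ell2_inner I x (y k))"
  using assms(2)
proof (induction F rule: infinite_finite_induct)
  case (insert k F)
  then show ?case
    using assms(1) by (simp add: ell2_inner_add_right ell2_inner_scale_right ell2_scale ell2_sum)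
qed (auto simp: ell2_inner_def)

lemma ell2_inner_sum_left:
  assumes "\<And>k. k \<in> F \<Longrightarrow> x k \<in> ell2 I" "y \<in> ell2 I"
  shows "ell2_inner I (\<lambda>i. \<Sum>k\<in>F. c k * x k i) y = (\<Sum>k\<in>F. cnj (c k) * ell2_inner I (x k) y)"
  by (subst (1 2) ell2_inner_commute) (simp add: ell2_inner_sum_right assms)

lemma ell2_inner_basis_left: "k \<in> I \<Longrightarrow> ell2_inner I (ell2_basis k) x = x k"
  unfolding ell2_inner_def ell2_basis_def
  by (subst infsum_cong_neutral[where T = "{k}" and g = x]) auto

lemma ell2_inner_self_has_sum:
  assumes "x \<in> ell2 I"
  shows "((\<lambda>i. (cmod (x i))\<^sup>2) has_sum Re (ell2_inner I x x)) I"
  using has_sum_Re[OF ell2_inner_has_sum[OF assms assms]]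
  by (simp add: complex_norm_square[symmetric] mult.commute[of "cnj _"])

lemma ell2_inner_self_nonneg: "x \<in> ell2 I \<Longrightarrow> 0 \<le> Re (ell2_inner I x x)"
  by (rule has_sum_nonneg[OF ell2_inner_self_has_sum]) auto

lemma ell2_Bessel:
  assumes "x \<in> ell2 I" "finite U" "U \<subseteq> I"
  shows "(\<Sum>i\<in>U. (cmod (x i))\<^sup>2) \<le> Re (ell2_inner I x x)"
  by (rule finite_sum_le_has_sum[OF ell2_inner_self_has_sum[OF assms(1)] assms(2,3)]) auto

lemma ell2_finite_support_self:
  assumes "finite U" "U \<subseteq> I"
  shows "ell2_inner I (\<lambda>i. \<Sum>k\<in>U. c k * ell2_basis k i) (\<lambda>i. \<Sum>k\<in>U. c k * ell2_basis k i)
    = of_real (\<Sum>k\<in>U. (cmod (c k))\<^sup>2)"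
proof -
  have "ell2_inner I (ell2_basis k) (\<lambda>i. \<Sum>k\<in>U. c k * ell2_basis k i) = c k" if "k \<in> U" for k
    using that assms by (subst ell2_inner_basis_left) (auto simp: ell2_basis_def if_distrib sum.If_cases Int_absorb1)
  then show ?thesis
    using assms
    by (simp add: ell2_inner_sum_left ell2_sum ell2_basis_in subset_iff
        complex_norm_square[symmetric] mult.commute[of "cnj _"] del: of_real_power)
qed

section \<open>Bounded operators and the matrix entries of a density operator\<close>

lemma operator_in_ell2: "bounded_operator I T \<Longrightarrow> x \<in> ell2 I \<Longrightarrow> T x \<in> ell2 I"
  unfolding bounded_operator_def by blast

lemma operator_add:
  "bounded_operator I T \<Longrightarrow> x \<in> ell2 I \<Longrightarrow> y \<in> ell2 I \<Longrightarrow>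
    T (\<lambda>i. x i + y i) = (\<lambda>i. T x i + T y i)"
  unfolding bounded_operator_def by simp

lemma operator_scale:
  "bounded_operator I T \<Longrightarrow> x \<in> ell2 I \<Longrightarrow> T (\<lambda>i. c * x i) = (\<lambda>i. c * T x i)"
  unfolding bounded_operator_def by simp

lemma operator_zero: "bounded_operator I T \<Longrightarrow> T (\<lambda>i. 0) = (\<lambda>i. 0)"
  using operator_scale[of I T "\<lambda>i. 0" 0] by (simp add: ell2_zero)

lemma operator_sum:
  assumes "bounded_operator I T" "\<And>k. k \<in> F \<Longrightarrow> x k \<in> ell2 I"
  shows "T (\<lambda>i. \<Sum>k\<in>F. c k * x k i) = (\<lambda>i. \<Sum>k\<in>F. c k * T (x k) i)"
  using assms(2)
proof (induction F rule: infinite_finite_induct)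
  case (insert k F)
  then show ?case
    using ell2_scale[of "x k" I] ell2_sum[of F x I c]
    by (simp add: operator_add[OF assms(1)] operator_scale[OF assms(1)])
qed (auto simp: operator_zero[OF assms(1)])

definition density_kernel :: "'u set \<Rightarrow> 'u operator \<Rightarrow> 'u \<Rightarrow> 'u \<Rightarrow> complex" where
  "density_kernel I \<rho> j k = ell2_inner I (ell2_basis j) (\<rho> (ell2_basis k))"

text \<open>Positivity forces symmetry, by polarization.\<close>

lemma density_operator_symmetric:
  assumes "density_operator I \<rho>" "x \<in> ell2 I" "y \<in> ell2 I"
  shows "ell2_inner I x (\<rho> y) = ell2_inner I (\<rho> x) y"
proof -
  have b: "bounded_operator I \<rho>" and nn: "\<And>x. x \<in> ell2 I \<Longrightarrow> Im (ell2_inner I x (\<rho> x)) = 0"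
    using assms(1) unfolding density_operator_def nonneg_complex_def by auto
  have "Im (c * ell2_inner I x (\<rho> y) + cnj c * ell2_inner I y (\<rho> x)) = 0" for c
  proof -
    have y: "(\<lambda>i. c * y i) \<in> ell2 I" using assms by (intro ell2_scale)
    have l: "\<rho> (\<lambda>i. x i + c * y i) = (\<lambda>i. \<rho> x i + c * \<rho> y i)"
      using assms y by (simp add: operator_add[OF b] operator_scale[OF b])
    have r: "\<rho> x \<in> ell2 I" "\<rho> y \<in> ell2 I" using operator_in_ell2[OF b] assms by auto
    have "ell2_inner I (\<lambda>i. x i + c * y i) (\<rho> (\<lambda>i. x i + c * y i))
        = ell2_inner I x (\<rho> x) + (c * ell2_inner I x (\<rho> y) + cnj c * ell2_inner I y (\<rho> x))
          + (cmod c)\<^sup>2 * ell2_inner I y (\<rho> y)"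
      using assms y r ell2_add[of _ I]  ell2_scale[of _ I]
      by (simp add: l ell2_inner_add_right ell2_inner_add_left ell2_inner_scale_left
          ell2_inner_scale_right algebra_simps) (simp add: complex_norm_square[symmetric])
    moreover have "Im (ell2_inner I (\<lambda>i. x i + c * y i) (\<rho> (\<lambda>i. x i + c * y i))) = 0"
      using assms y by (intro nn ell2_add)
    ultimately show ?thesis using nn[OF assms(2)] nn[OF assms(3)] by simp
  qed
  \<comment> \<open>The value 1 makes the imaginary parts of the two inner products opposite, the
    value \<i> makes their real parts equal.\<close>
  from this[of 1] this[of \<i>] have "ell2_inner I x (\<rho> y) = cnj (ell2_inner I y (\<rho> x))"
    by (simp add: complex_eq_iff)
  then show ?thesis using ell2_inner_commute[of I "\<rho> x" y] by simp
qed

lemma density_operator_nonneg: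
  "density_operator I \<rho> \<Longrightarrow> x \<in> ell2 I \<Longrightarrow> 0 \<le> Re (ell2_inner I x (\<rho> x))"
  unfolding density_operator_def nonneg_complex_def by blast

text \<open>At coefficients \<open>c\<close> the form of the kernel is the quadratic form of \<rho>
  at the finitely supported vector with coordinates \<open>c\<close>.\<close>

lemma density_kernel_pos:
  assumes "density_operator I \<rho>" "F \<subseteq> I"
  shows "pos_kernel F (density_kernel I \<rho>)"
  unfolding pos_kernel_def
proof (intro conjI allI ballI)
  fix j k assume "j \<in> F" "k \<in> F"
  then show "density_kernel I \<rho> k j = cnj (density_kernel I \<rho> j k)"
    unfolding density_kernel_def using assms
    by (subst density_operator_symmetric) (auto simp: ell2_basis_in ell2_inner_commute[symmetric])
next
  fix c :: "'a \<Rightarrow> complex"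
  have b: "bounded_operator I \<rho>" using assms(1) by (simp add: density_operator_def)
  have e: "\<And>k. k \<in> F \<Longrightarrow> ell2_basis k \<in> ell2 I" using assms(2) by (auto intro: ell2_basis_in)
  let ?x = "\<lambda>i. \<Sum>k\<in>F. c k * ell2_basis k i"
  have "ell2_inner I ?x (\<rho> ?x) = (\<Sum>j\<in>F. \<Sum>k\<in>F. cnj (c j) * density_kernel I \<rho> j k * c k)"
    using e operator_in_ell2[OF b]
    by (simp add: operator_sum[OF b] ell2_inner_sum_left ell2_inner_sum_right ell2_sum
        density_kernel_def sum_distrib_left mult_ac)
  moreover have "?x \<in> ell2 I" using e by (rule ell2_sum)
  ultimately show "0 \<le> Re (\<Sum>j\<in>F. \<Sum>k\<in>F. cnj (c j) * density_kernel I \<rho> j k * c k)"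
    using density_operator_nonneg[OF assms(1), of ?x] by simp
qed

section \<open>The Lovasz bound for operators\<close>

text \<open>Without a bound the real \<open>Sup\<close> would say nothing about its members. By
  Cauchy-Schwarz each squared overlap is at most 1, so the total weight is a bound.\<close>

lemma weighted_lovasz_bdd_above:
  assumes "finite (verts G)" "\<forall>i\<in>verts G. 0 \<le> w i"
  shows "bdd_above {\<Sum>i\<in>verts G. w i * \<bar>\<phi> \<bullet> v i\<bar>\<^sup>2 | (d :: nat) (\<phi> :: real vec) (v :: 'v \<Rightarrow> real vec).
            \<phi> \<in> carrier_vec d \<and> \<phi> \<bullet> \<phi> = 1 \<and>
            (\<forall>i\<in>verts G. v i \<in> carrier_vec d \<and> v i \<bullet> v i = 1) \<and>
            (\<forall>i\<in>verts G. \<forall>j\<in>verts G. {i, j} \<in> edges G \<longrightarrow> v i \<bullet> v j = 0)}"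
proof (rule bdd_aboveI, clarify)
  fix d :: nat and \<phi> :: "real vec" and v :: "'v \<Rightarrow> real vec"
  assume \<phi>: "\<phi> \<in> carrier_vec d" "\<phi> \<bullet> \<phi> = 1"
    and v: "\<forall>i\<in>verts G. v i \<in> carrier_vec d \<and> v i \<bullet> v i = 1"
  have "\<bar>\<phi> \<bullet> v i\<bar>\<^sup>2 \<le> 1" if "i \<in> verts G" for i
  proof -
    have vi: "v i \<in> carrier_vec d" "v i \<bullet> v i = 1" using v that by auto
    have "(\<phi> \<bullet> v i)\<^sup>2 \<le> (\<phi> \<bullet> \<phi>) * (v i \<bullet> v i)"
      using Cauchy_Schwarz_ineq_sum[of "\<lambda>k. \<phi> $ k" "\<lambda>k. v i $ k" "{0..<d}"] \<phi>(1) vi(1)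
      by (simp add: scalar_prod_def power2_eq_square)
    then show ?thesis using \<phi> vi by simp
  qed
  then show "(\<Sum>i\<in>verts G. w i * \<bar>\<phi> \<bullet> v i\<bar>\<^sup>2) \<le> (\<Sum>i\<in>verts G. w i * 1)"
    using assms(2) by (intro sum_mono mult_left_mono) auto
qed

text \<open>Vectors coming from a Gram factorization carry a natural finite index set
  \<open>Z\<close>; enumerating it turns them into the numbered coordinates that
  \<open>weighted_lovasz\<close> asks for.\<close>

lemma weighted_lovasz_upper:
  fixes \<phi> :: "'z \<Rightarrow> real" and u :: "'v \<Rightarrow> 'z \<Rightarrow> real"
  assumes "finite (verts G)" "\<forall>i\<in>verts G. 0 \<le> w i" "finite Z"
    and "(\<Sum>z\<in>Z. \<phi> z * \<phi> z) = 1"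
    and "\<And>i. i \<in> verts G \<Longrightarrow> (\<Sum>z\<in>Z. u i z * u i z) = 1"
    and "\<And>i j. i \<in> verts G \<Longrightarrow> j \<in> verts G \<Longrightarrow> {i, j} \<in> edges G \<Longrightarrow> (\<Sum>z\<in>Z. u i z * u j z) = 0"
  shows "(\<Sum>i\<in>verts G. w i * (\<Sum>z\<in>Z. \<phi> z * u i z)\<^sup>2) \<le> weighted_lovasz G w"
proof -
  obtain e where e: "bij_betw e {0..<card Z} Z" using ex_bij_betw_nat_finite[OF assms(3)] by blast
  define V where "V f = vec (card Z) (\<lambda>k. f (e k) :: real)" for f
  have V: "V f \<bullet> V g = (\<Sum>z\<in>Z. f z * g z)" for f g
    unfolding V_def scalar_prod_def by (simp add: sum.reindex_bij_betw[OF e, symmetric])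
  have c: "V f \<in> carrier_vec (card Z)" for f by (simp add: V_def)
  have "(\<Sum>i\<in>verts G. w i * \<bar>V \<phi> \<bullet> V (u i)\<bar>\<^sup>2) \<le> weighted_lovasz G w"
    unfolding weighted_lovasz_def
    by (rule cSup_upper[OF _ weighted_lovasz_bdd_above[OF assms(1,2)]], rule CollectI,
        rule exI[of _ "card Z"], rule exI[of _ "V \<phi>"], rule exI[of _ "\<lambda>i. V (u i)"])
      (use assms(4-6) c V in auto)
  then show ?thesis by (simp add: V)
qed

lemma self_adjoint_bounded: "self_adjoint I T \<Longrightarrow> bounded_operator I T"
  by (simp add: self_adjoint_def)

lemma self_adjoint_inner:
  "self_adjoint I T \<Longrightarrow> x \<in> ell2 I \<Longrightarrow> y \<in> ell2 I \<Longrightarrow> ell2_inner I (T x) y = ell2_inner I x (T y)"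
  by (simp add: self_adjoint_def)

text \<open>The Gram matrix of the identity (index \<open>None\<close>) and the \<open>S i\<close> with respect to the form
  \<open>(A, B) \<mapsto> \<Sum>l. \<langle>A (y l), B (y l)\<rangle> / t\<close> is positive. Its factorization yields complex vectors, whose
  real and imaginary parts are the entries of a Lovasz configuration: anti-commutation kills the
  real part of the corresponding entry.\<close>

lemma mixture_le_lovasz:
  fixes w :: "'v \<Rightarrow> real"
  assumes fin: "finite (verts G)" and w: "\<forall>i\<in>verts G. 0 \<le> w i" and loop: "\<And>i. {i} \<notin> edges G"
    and rep: "self_adjoint_unitary_rep G I S"
    and y: "\<And>l. l \<in> L \<Longrightarrow> y l \<in> ell2 I"
    and t: "t = (\<Sum>l\<in>L. Re (ell2_inner I (y l) (y l)))" "0 < t"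
  shows "(\<Sum>i\<in>verts G. w i * (\<Sum>l\<in>L. Re (ell2_inner I (y l) (S i (y l))))\<^sup>2) \<le> t\<^sup>2 * weighted_lovasz G w"
proof -
  define X where "X = insert None (Some ` verts G)"
  have "finite X" using fin by (simp add: X_def)
  define T where "T p = (case p of None \<Rightarrow> (\<lambda>x. x) | Some i \<Rightarrow> S i)" for p
  have sa: "self_adjoint I (S i)" and inv: "\<And>x. x \<in> ell2 I \<Longrightarrow> S i (S i x) = x" if "i \<in> verts G" for i
    using rep that unfolding self_adjoint_unitary_rep_def by auto
  have Ty: "T p (y l) \<in> ell2 I" if "p \<in> X" "l \<in> L" for p l
    using that y[OF that(2)] operator_in_ell2[OF self_adjoint_bounded[OF sa] y[OF that(2)]]
    by (cases p) (auto simp: X_def T_def)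
  \<comment> \<open>Division by \<open>t\<close> makes the real parts of all diagonal entries 1, so
    that unit vectors result.\<close>
  define M where "M p q = (\<Sum>l\<in>L. ell2_inner I (T p (y l)) (T q (y l))) / of_real t" for p q
  have "pos_kernel X M"
    unfolding pos_kernel_def
  proof (intro conjI allI ballI)
    fix p q show "M q p = cnj (M p q)"
      by (simp add: M_def ell2_inner_commute[symmetric])
  next
    fix c :: "'v option \<Rightarrow> complex"
    let ?x = "\<lambda>l i. \<Sum>p\<in>X. c p * T p (y l) i"
    have "(\<Sum>p\<in>X. \<Sum>q\<in>X. cnj (c p) * M p q * c q)
        = (\<Sum>p\<in>X. \<Sum>q\<in>X. \<Sum>l\<in>L. cnj (c p) * (c q * ell2_inner I (T p (y l)) (T q (y l)))) / of_real t"
      by (simp add: M_def sum_divide_distrib sum_distrib_left sum_distrib_right mult_ac)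
    also have "(\<Sum>p\<in>X. \<Sum>q\<in>X. \<Sum>l\<in>L. cnj (c p) * (c q * ell2_inner I (T p (y l)) (T q (y l))))
        = (\<Sum>p\<in>X. \<Sum>l\<in>L. \<Sum>q\<in>X. cnj (c p) * (c q * ell2_inner I (T p (y l)) (T q (y l))))"
      by (intro sum.cong refl sum.swap)
    also have "\<dots> = (\<Sum>l\<in>L. \<Sum>p\<in>X. \<Sum>q\<in>X. cnj (c p) * (c q * ell2_inner I (T p (y l)) (T q (y l))))"
      by (rule sum.swap)
    also have "\<dots> = (\<Sum>l\<in>L. ell2_inner I (?x l) (?x l))"
      by (simp add: ell2_inner_sum_left ell2_inner_sum_right ell2_sum Ty sum_distrib_left)
    finally show "0 \<le> Re (\<Sum>p\<in>X. \<Sum>q\<in>X. cnj (c p) * M p q * c q)"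
      using t(2) Ty by (simp add: sum_nonneg ell2_inner_self_nonneg ell2_sum)
  qed
  from pos_kernel_factor[OF \<open>finite X\<close> this] obtain \<psi> where
    \<psi>: "\<And>p q. p \<in> X \<Longrightarrow> q \<in> X \<Longrightarrow> M p q = (\<Sum>l\<in>X. \<psi> l p * cnj (\<psi> l q))" by blast
  define u where "u p z = (if snd z then Re (\<psi> (fst z) p) else Im (\<psi> (fst z) p))"
    for p and z :: "'v option \<times> bool"
  define Z where "Z = X \<times> (UNIV :: bool set)"
  have u: "(\<Sum>z\<in>Z. u p z * u q z) = Re (M p q)" if "p \<in> X" "q \<in> X" for p q
  proof -
    have "(\<Sum>z\<in>Z. u p z * u q z) = (\<Sum>l\<in>X. \<Sum>b\<in>UNIV. u p (l, b) * u q (l, b))"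
      by (simp add: Z_def sum.cartesian_product split_def)
    then show ?thesis by (simp add: \<psi>[OF that] u_def UNIV_bool add.commute)
  qed
  have X: "None \<in> X" "\<And>i. i \<in> verts G \<Longrightarrow> Some i \<in> X" by (auto simp: X_def)
  have "(\<Sum>i\<in>verts G. w i * (\<Sum>z\<in>Z. u None z * u (Some i) z)\<^sup>2) \<le> weighted_lovasz G w"
  proof (rule weighted_lovasz_upper[OF fin w])
    show "finite Z" using \<open>finite X\<close> by (simp add: Z_def)
    show "(\<Sum>z\<in>Z. u None z * u None z) = 1"
      using t X by (simp add: u M_def T_def)
    show "(\<Sum>z\<in>Z. u (Some i) z * u (Some i) z) = 1" if i: "i \<in> verts G" for i
    proof -
      have "ell2_inner I (S i (y l)) (S i (y l)) = ell2_inner I (y l) (y l)" if "l \<in> L" for l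
        using Ty[OF X(2)[OF i] that]
        by (simp add: T_def self_adjoint_inner[OF sa[OF i] y[OF that]] inv[OF i y[OF that]])
      then show ?thesis using t X i by (simp add: u M_def T_def)
    qed
    fix i j assume ij: "i \<in> verts G" "j \<in> verts G" "{i, j} \<in> edges G"
    \<comment> \<open>The orthogonality condition of \<open>weighted_lovasz\<close> also ranges over
      \<open>i = j\<close>, while a representation constrains only distinct vertices; the absence of
      loops closes this gap.\<close>
    then have "i \<noteq> j" using loop by auto
    have anti: "\<And>x. x \<in> ell2 I \<Longrightarrow> S i (S j x) = (\<lambda>k. - S j (S i x) k)"
      using rep ij \<open>i \<noteq> j\<close> unfolding self_adjoint_unitary_rep_def by meson
    have "Re (ell2_inner I (S i (y l)) (S j (y l))) = 0" if l: "l \<in> L" for l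
    proof -
      note yl = y[OF l] and Si = Ty[OF X(2)[OF ij(1)] l, unfolded T_def, simplified]
        and Sj = Ty[OF X(2)[OF ij(2)] l, unfolded T_def, simplified]
      have "ell2_inner I (S i (y l)) (S j (y l)) = ell2_inner I (y l) (S i (S j (y l)))"
        by (rule self_adjoint_inner[OF sa[OF ij(1)] yl Sj])
      also have "\<dots> = - ell2_inner I (y l) (S j (S i (y l)))"
        using ell2_inner_scale_right[of I "y l" "-1" "S j (S i (y l))"] by (simp add: anti[OF yl])
      also have "ell2_inner I (y l) (S j (S i (y l))) = ell2_inner I (S j (y l)) (S i (y l))"
        by (rule self_adjoint_inner[OF sa[OF ij(2)] yl Si, symmetric])
      also have "\<dots> = cnj (ell2_inner I (S i (y l)) (S j (y l)))" by (rule ell2_inner_commute)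
      finally show ?thesis by (simp add: complex_eq_iff)
    qed
    then show "(\<Sum>z\<in>Z. u (Some i) z * u (Some j) z) = 0"
      using X ij by (simp add: u M_def T_def)
  qed
  \<comment> \<open>The overlap is the unnormalised expectation over \<open>t\<close>, which is
    where the factor \<open>t\<^sup>2\<close> comes from.\<close>
  moreover have "(\<Sum>z\<in>Z. u None z * u (Some i) z) = (\<Sum>l\<in>L. Re (ell2_inner I (y l) (S i (y l)))) / t"
    if "i \<in> verts G" for i
    using X that by (simp add: u M_def T_def)
  ultimately show ?thesis
    using t(2) by (simp add: power_divide sum_divide_distrib[symmetric] divide_le_eq mult.commute)
qed

section \<open>Finite truncations of a density operator\<close>

lemma density_kernel_sum_truncated:
  assumes "\<And>j k. j \<in> F \<Longrightarrow> k \<in> F \<Longrightarrow> r j k = (\<Sum>l\<in>F. \<psi> l j * cnj (\<psi> l k))"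
    and "F \<subseteq> I" "bounded_operator I T"
    and y: "\<And>l. y l = (\<lambda>i. \<Sum>k\<in>F. \<psi> l k * ell2_basis k i)"
  shows "(\<Sum>j\<in>F. \<Sum>k\<in>F. r k j * T (ell2_basis k) j) = (\<Sum>l\<in>F. ell2_inner I (y l) (T (y l)))"
proof -
  have e: "\<And>k. k \<in> F \<Longrightarrow> ell2_basis k \<in> ell2 I" using assms(2) by (auto intro: ell2_basis_in)
  \<comment> \<open>The trace of a rank-one operator times \<open>T\<close> is the quadratic form of
    \<open>T\<close> at its vector; summed over \<open>l\<close>, these rank-one operators make up
    \<open>r\<close>.\<close>
  have "ell2_inner I (y l) (T (y l)) = (\<Sum>j\<in>F. \<Sum>k\<in>F. \<psi> l k * cnj (\<psi> l j) * T (ell2_basis k) j)" for l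
    unfolding y using e operator_in_ell2[OF assms(3)] assms(2)
    by (simp add: operator_sum[OF assms(3)] ell2_inner_sum_left ell2_sum subset_iff
        ell2_inner_basis_left sum_distrib_left) (simp add: mult_ac)
  then have "(\<Sum>l\<in>F. ell2_inner I (y l) (T (y l)))
      = (\<Sum>j\<in>F. \<Sum>l\<in>F. \<Sum>k\<in>F. \<psi> l k * cnj (\<psi> l j) * T (ell2_basis k) j)"
    by (simp only:) (rule sum.swap)
  also have "\<dots> = (\<Sum>j\<in>F. \<Sum>k\<in>F. \<Sum>l\<in>F. \<psi> l k * cnj (\<psi> l j) * T (ell2_basis k) j)"
    by (intro sum.cong refl sum.swap)
  also have "\<dots> = (\<Sum>j\<in>F. \<Sum>k\<in>F. r k j * T (ell2_basis k) j)"
    by (simp add: assms(1) sum_distrib_right)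
  finally show ?thesis ..
qed

text \<open>Cauchy-Schwarz over the pairs \<open>(j, l)\<close>, with \<open>l\<close> numbering the
  vectors of the mixture. One factor is the trace over \<open>U\<close>. The other is bounded by the
  trace over \<open>V\<close>, because a self-adjoint involution preserves the norms of the vectors
  cut to \<open>V\<close>.\<close>

lemma density_kernel_block_bound:
  assumes "density_operator I \<rho>" "self_adjoint I S" "\<And>x. x \<in> ell2 I \<Longrightarrow> S (S x) = x"
    and "finite U" "finite V" "U \<subseteq> I" "V \<subseteq> I"
  shows "(cmod (\<Sum>j\<in>U. \<Sum>k\<in>V. density_kernel I \<rho> k j * S (ell2_basis k) j))\<^sup>2
    \<le> (\<Sum>j\<in>U. Re (density_kernel I \<rho> j j)) * (\<Sum>k\<in>V. Re (density_kernel I \<rho> k k))"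
proof -
  define L where "L = U \<union> V"
  have L: "finite L" "L \<subseteq> I" "U \<subseteq> L" "V \<subseteq> L" using assms by (auto simp: L_def)
  \<comment> \<open>Factoring on the union lets one family of vectors describe both \<open>U\<close>
    and \<open>V\<close>.\<close>
  define r where "r = density_kernel I \<rho>"
  obtain \<psi> where \<psi>: "\<And>j k. j \<in> L \<Longrightarrow> k \<in> L \<Longrightarrow> r j k = (\<Sum>l\<in>L. \<psi> l j * cnj (\<psi> l k))"
    using pos_kernel_factor[OF L(1) density_kernel_pos[OF assms(1) L(2)]] unfolding r_def by blast
  have diag: "Re (r j j) = (\<Sum>l\<in>L. (cmod (\<psi> l j))\<^sup>2)" if "j \<in> L" for j
    using that by (simp add: \<psi> complex_norm_square[symmetric] del: of_real_power)
  have b: "bounded_operator I S" using assms(2) by (rule self_adjoint_bounded)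
  have e: "\<And>k. k \<in> V \<Longrightarrow> ell2_basis k \<in> ell2 I" using assms(7) by (auto intro: ell2_basis_in)
  define y where "y l = (\<lambda>i. \<Sum>k\<in>V. \<psi> l k * ell2_basis k i)" for l
  have y: "y l \<in> ell2 I" for l unfolding y_def using e by (rule ell2_sum)
  have Sy: "S (y l) j = (\<Sum>k\<in>V. \<psi> l k * S (ell2_basis k) j)" for l j
    unfolding y_def using e by (simp add: operator_sum[OF b])
  have "(\<Sum>j\<in>U. \<Sum>k\<in>V. r k j * S (ell2_basis k) j)
      = (\<Sum>j\<in>U. \<Sum>k\<in>V. \<Sum>l\<in>L. \<psi> l k * cnj (\<psi> l j) * S (ell2_basis k) j)"
    using L by (simp add: \<psi> subset_iff sum_distrib_right)
  also have "\<dots> = (\<Sum>j\<in>U. \<Sum>l\<in>L. cnj (\<psi> l j) * S (y l) j)"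
    unfolding Sy sum_distrib_left by (subst (2) sum.swap) (simp add: mult_ac)
  also have "\<dots> = (\<Sum>(j, l)\<in>U \<times> L. cnj (\<psi> l j) * S (y l) j)"
    by (simp add: sum.cartesian_product)
  finally have "cmod (\<Sum>j\<in>U. \<Sum>k\<in>V. r k j * S (ell2_basis k) j)
      \<le> (\<Sum>z\<in>U \<times> L. cmod (\<psi> (snd z) (fst z)) * cmod (S (y (snd z)) (fst z)))"
    by (auto intro!: sum_norm_le simp: norm_mult split_def)
  then have "(cmod (\<Sum>j\<in>U. \<Sum>k\<in>V. r k j * S (ell2_basis k) j))\<^sup>2
      \<le> (\<Sum>z\<in>U \<times> L. cmod (\<psi> (snd z) (fst z)) * cmod (S (y (snd z)) (fst z)))\<^sup>2"
    by (rule power_mono) simp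
  also have "\<dots> \<le> (\<Sum>z\<in>U \<times> L. (cmod (\<psi> (snd z) (fst z)))\<^sup>2)
      * (\<Sum>z\<in>U \<times> L. (cmod (S (y (snd z)) (fst z)))\<^sup>2)"
    by (rule Cauchy_Schwarz_ineq_sum)
  also have "(\<Sum>z\<in>U \<times> L. (cmod (\<psi> (snd z) (fst z)))\<^sup>2) = (\<Sum>j\<in>U. Re (r j j))"
    using L by (simp add: diag subset_iff sum.cartesian_product split_def)
  also have "(\<Sum>z\<in>U \<times> L. (cmod (S (y (snd z)) (fst z)))\<^sup>2) = (\<Sum>l\<in>L. \<Sum>j\<in>U. (cmod (S (y l) j))\<^sup>2)"
    by (subst sum.swap) (simp add: sum.cartesian_product split_def)
  also have "(\<Sum>j\<in>U. Re (r j j)) * (\<Sum>l\<in>L. \<Sum>j\<in>U. (cmod (S (y l) j))\<^sup>2)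
      \<le> (\<Sum>j\<in>U. Re (r j j)) * (\<Sum>l\<in>L. \<Sum>k\<in>V. (cmod (\<psi> l k))\<^sup>2)"
  proof (intro mult_left_mono sum_mono)
    fix l assume "l \<in> L"
    have "(\<Sum>j\<in>U. (cmod (S (y l) j))\<^sup>2) \<le> Re (ell2_inner I (S (y l)) (S (y l)))"
      by (rule ell2_Bessel[OF operator_in_ell2[OF b y] assms(4,6)])
    also have "ell2_inner I (S (y l)) (S (y l)) = ell2_inner I (y l) (y l)"
      using self_adjoint_inner[OF assms(2) y operator_in_ell2[OF b y]] assms(3)[OF y] by simp
    also have "Re \<dots> = (\<Sum>k\<in>V. (cmod (\<psi> l k))\<^sup>2)"
      unfolding y_def using assms by (subst ell2_finite_support_self) auto
    finally show "(\<Sum>j\<in>U. (cmod (S (y l) j))\<^sup>2) \<le> (\<Sum>k\<in>V. (cmod (\<psi> l k))\<^sup>2)" .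
  next
    show "0 \<le> (\<Sum>j\<in>U. Re (r j j))" using L by (intro sum_nonneg) (auto simp: diag subset_iff intro: sum_nonneg)
  qed
  also have "(\<Sum>l\<in>L. \<Sum>k\<in>V. (cmod (\<psi> l k))\<^sup>2) = (\<Sum>k\<in>V. Re (r k k))"
    using L by (subst sum.swap) (simp add: diag subset_iff)
  finally show ?thesis unfolding r_def .
qed

text \<open>Makes the trace of a truncation an instance of
  \<open>density_kernel_sum_truncated\<close>.\<close>

lemma bounded_operator_id: "bounded_operator I (\<lambda>x. x)"
  unfolding bounded_operator_def by (auto intro!: exI[of _ 1])

lemma density_kernel_trace:
  assumes "density_operator I \<rho>"
  shows "((\<lambda>k. Re (density_kernel I \<rho> k k)) has_sum 1) I"
  using assms has_sum_Re[of "\<lambda>k. density_kernel I \<rho> k k" I 1]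
  unfolding density_operator_def density_kernel_def by simp

lemma density_kernel_diag_nonneg:
  assumes "density_operator I \<rho>" "k \<in> I"
  shows "0 \<le> Re (density_kernel I \<rho> k k)"
  unfolding density_kernel_def using assms by (intro density_operator_nonneg ell2_basis_in)

lemma density_kernel_trace_le:
  assumes "density_operator I \<rho>" "finite F" "F \<subseteq> I"
  shows "(\<Sum>k\<in>F. Re (density_kernel I \<rho> k k)) \<le> 1"
  by (rule finite_sum_le_has_sum[OF density_kernel_trace[OF assms(1)] assms(2,3)])
    (use assms(1) density_kernel_diag_nonneg in auto)

text \<open>Symmetry moves \<rho> onto the basis vector; what remains is the coordinate expansion of
  an inner product instead of an exchange of \<rho> with an infinite sum.\<close>

lemma density_kernel_row_has_sum:
  assumes "density_operator I \<rho>" "k \<in> I" "x \<in> ell2 I"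
  shows "((\<lambda>j. density_kernel I \<rho> k j * x j) has_sum ell2_inner I (ell2_basis k) (\<rho> x)) I"
proof -
  have b: "bounded_operator I \<rho>" using assms(1) by (simp add: density_operator_def)
  have k: "ell2_basis k \<in> ell2 I" using assms(2) by (rule ell2_basis_in)
  have "density_kernel I \<rho> k j = cnj (\<rho> (ell2_basis k) j)" if "j \<in> I" for j
    unfolding density_kernel_def density_operator_symmetric[OF assms(1) k ell2_basis_in[OF that]]
      ell2_inner_commute[of I _ "ell2_basis j"]
    using that by (simp add: ell2_inner_basis_left)
  with ell2_inner_has_sum[OF operator_in_ell2[OF b k] assms(3)] show ?thesis
    unfolding density_operator_symmetric[OF assms(1) k assms(3)]
    by (simp cong: has_sum_cong)
qed

text \<open>The error is an off-diagonal block, controlled by the trace of \<open>\<rho>\<close> outside \<open>K\<close>.\<close>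

lemma truncation_error:
  assumes \<rho>: "density_operator I \<rho>"
    and S: "self_adjoint I S" "\<And>x. x \<in> ell2 I \<Longrightarrow> S (S x) = x"
    and K: "finite K" "K \<subseteq> I"
  shows "cmod ((\<Sum>k\<in>K. ell2_inner I (ell2_basis k) (\<rho> (S (ell2_basis k))))
      - (\<Sum>j\<in>K. \<Sum>k\<in>K. density_kernel I \<rho> k j * S (ell2_basis k) j))
    \<le> sqrt (1 - (\<Sum>k\<in>K. Re (density_kernel I \<rho> k k)))"
proof -
  define r where "r = density_kernel I \<rho>"
  \<comment> \<open>\<open>sum g F\<close> pairs the rows of \<open>r\<close> in \<open>K\<close>
    with the columns in \<open>F\<close>. It is the \<open>K\<close> by \<open>K\<close> corner for
    \<open>F = K\<close> and tends to the partial sum of the trace as \<open>F\<close>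
    grows.\<close>
  define g where "g j = (\<Sum>k\<in>K. r k j * S (ell2_basis k) j)" for j
  let ?t = "\<Sum>k\<in>K. Re (r k k)"
  have Se: "S (ell2_basis k) \<in> ell2 I" if "k \<in> K" for k
    using that K(2) by (intro operator_in_ell2[OF self_adjoint_bounded[OF S(1)]] ell2_basis_in) auto
  have "((\<lambda>F. \<Sum>k\<in>K. \<Sum>j\<in>F. r k j * S (ell2_basis k) j)
      \<longlongrightarrow> (\<Sum>k\<in>K. ell2_inner I (ell2_basis k) (\<rho> (S (ell2_basis k))))) (finite_subsets_at_top I)"
    using K(2) Se density_kernel_row_has_sum[OF \<rho>]
    by (intro tendsto_sum) (auto simp: has_sum_def r_def)
  moreover have "sum g = (\<lambda>F. \<Sum>k\<in>K. \<Sum>j\<in>F. r k j * S (ell2_basis k) j)"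
    unfolding g_def by (rule ext) (rule sum.swap)
  ultimately have lim: "((\<lambda>F. cmod (sum g F - sum g K))
      \<longlongrightarrow> cmod ((\<Sum>k\<in>K. ell2_inner I (ell2_basis k) (\<rho> (S (ell2_basis k)))) - sum g K))
      (finite_subsets_at_top I)"
    by (intro tendsto_intros) simp
  \<comment> \<open>The difference is the block with columns in \<open>F - K\<close>. Its squared
    modulus is at most the trace over \<open>F - K\<close> times \<open>?t\<close>; the former is at
    most \<open>1 - ?t\<close>, the latter at most 1.\<close>
  have "cmod (sum g F - sum g K) \<le> sqrt (1 - ?t)" if F: "finite F" "K \<subseteq> F" "F \<subseteq> I" for F
  proof -
    have "(\<Sum>j\<in>F - K. Re (r j j)) + ?t \<le> 1"
      using density_kernel_trace_le[OF \<rho> F(1,3)] sum.subset_diff[OF F(2,1), of "\<lambda>k. Re (r k k)"]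
      by (simp add: r_def)
    moreover have "(cmod (\<Sum>j\<in>F - K. g j))\<^sup>2 \<le> (\<Sum>j\<in>F - K. Re (r j j)) * ?t"
      unfolding g_def r_def using F K by (intro density_kernel_block_bound[OF \<rho> S]) auto
    moreover have "(\<Sum>j\<in>F - K. Re (r j j)) * ?t \<le> (\<Sum>j\<in>F - K. Re (r j j)) * 1"
      using density_kernel_trace_le[OF \<rho> K] density_kernel_diag_nonneg[OF \<rho>] F(3)
      by (intro mult_left_mono sum_nonneg) (auto simp: r_def)
    ultimately have "(cmod (\<Sum>j\<in>F - K. g j))\<^sup>2 \<le> 1 - ?t" by linarith
    moreover have "sum g F - sum g K = (\<Sum>j\<in>F - K. g j)"
      using sum_diff[OF F(1,2)] by metis
    ultimately show ?thesis by (simp add: real_le_rsqrt)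
  qed
  then have "\<forall>\<^sub>F F in finite_subsets_at_top I. cmod (sum g F - sum g K) \<le> sqrt (1 - ?t)"
    unfolding eventually_finite_subsets_at_top using K by blast
  with lim have "cmod ((\<Sum>k\<in>K. ell2_inner I (ell2_basis k) (\<rho> (S (ell2_basis k)))) - sum g K)
      \<le> sqrt (1 - ?t)"
    by (rule tendsto_upperbound) simp
  then show ?thesis unfolding g_def r_def .
qed

text \<open>The partial sums converge to the expectation by \<open>sm\<close>, and the corners
  differ from them by at most the square root of the trace left outside \<open>K\<close>, which
  tends to 0. Summability is assumed because a divergent \<open>infsum\<close> has the default value
  0.\<close>

lemma truncation_tendsto:
  assumes \<rho>: "density_operator I \<rho>"
    and S: "self_adjoint I S" "\<And>x. x \<in> ell2 I \<Longrightarrow> S (S x) = x"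
    and sm: "(\<lambda>k. ell2_inner I (ell2_basis k) (\<rho> (S (ell2_basis k)))) summable_on I"
  shows "((\<lambda>K. Re (\<Sum>j\<in>K. \<Sum>k\<in>K. density_kernel I \<rho> k j * S (ell2_basis k) j))
    \<longlongrightarrow> expectation I \<rho> S) (finite_subsets_at_top I)"
proof -
  let ?h = "\<lambda>K. \<Sum>k\<in>K. ell2_inner I (ell2_basis k) (\<rho> (S (ell2_basis k)))"
  let ?f = "\<lambda>K. \<Sum>j\<in>K. \<Sum>k\<in>K. density_kernel I \<rho> k j * S (ell2_basis k) j"
  let ?t = "\<lambda>K. \<Sum>k\<in>K. Re (density_kernel I \<rho> k k)"
  have "(?t \<longlongrightarrow> 1) (finite_subsets_at_top I)"
    using density_kernel_trace[OF \<rho>] by (simp add: has_sum_def)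
  then have "((\<lambda>K. sqrt (1 - ?t K)) \<longlongrightarrow> sqrt (1 - 1)) (finite_subsets_at_top I)"
    by (intro tendsto_intros)
  then have "((\<lambda>K. sqrt (1 - ?t K)) \<longlongrightarrow> 0) (finite_subsets_at_top I)" by simp
  moreover have "\<forall>\<^sub>F K in finite_subsets_at_top I. norm (?h K - ?f K) \<le> sqrt (1 - ?t K)"
    using truncation_error[OF \<rho> S] by (intro eventually_finite_subsets_at_top_weakI) auto
  then have "\<forall>\<^sub>F K in finite_subsets_at_top I. norm (?h K - ?f K) \<le> norm (sqrt (1 - ?t K)) * 1"
    by eventually_elim (unfold real_norm_def mult_1_right, erule order_trans[OF _ abs_ge_self])
  ultimately have "((\<lambda>K. ?h K - ?f K) \<longlongrightarrow> 0) (finite_subsets_at_top I)"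
    by (rule tendsto_0_le)
  moreover have "(?h \<longlongrightarrow> (\<Sum>\<^sub>\<infinity>k\<in>I. ell2_inner I (ell2_basis k) (\<rho> (S (ell2_basis k))))) (finite_subsets_at_top I)"
    using has_sum_infsum[OF sm] by (simp add: has_sum_def)
  ultimately have "((\<lambda>K. ?h K - (?h K - ?f K))
      \<longlongrightarrow> (\<Sum>\<^sub>\<infinity>k\<in>I. ell2_inner I (ell2_basis k) (\<rho> (S (ell2_basis k)))) - 0) (finite_subsets_at_top I)"
    by (intro tendsto_diff)
  then have "(?f \<longlongrightarrow> (\<Sum>\<^sub>\<infinity>k\<in>I. ell2_inner I (ell2_basis k) (\<rho> (S (ell2_basis k))))) (finite_subsets_at_top I)"
    by simp
  then show ?thesis unfolding expectation_def by (rule tendsto_Re)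
qed

text \<open>The corner of \<rho> on \<open>K\<close> is a mixture, of total weight \<open>t\<close>,
  of the vector states given by its Cholesky factors, so \<open>mixture_le_lovasz\<close>
  applies.\<close>

lemma truncation_le_lovasz:
  fixes w :: "'v \<Rightarrow> real"
  assumes fin: "finite (verts G)" and w: "\<forall>i\<in>verts G. 0 \<le> w i" and loop: "\<And>i. {i} \<notin> edges G"
    and rep: "self_adjoint_unitary_rep G I S" and \<rho>: "density_operator I \<rho>"
    and K: "finite K" "K \<subseteq> I" and t: "t = (\<Sum>k\<in>K. Re (density_kernel I \<rho> k k))" "0 < t"
  shows "(\<Sum>i\<in>verts G. w i * (Re (\<Sum>j\<in>K. \<Sum>k\<in>K. density_kernel I \<rho> k j * S i (ell2_basis k) j))\<^sup>2)
    \<le> t\<^sup>2 * weighted_lovasz G w"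
proof -
  obtain \<psi> where \<psi>: "\<And>j k. j \<in> K \<Longrightarrow> k \<in> K \<Longrightarrow>
      density_kernel I \<rho> j k = (\<Sum>l\<in>K. \<psi> l j * cnj (\<psi> l k))"
    using pos_kernel_factor[OF K(1) density_kernel_pos[OF \<rho> K(2)]] by blast
  define y where "y l = (\<lambda>i. \<Sum>k\<in>K. \<psi> l k * ell2_basis k i)" for l
  have y: "y l \<in> ell2 I" for l
    unfolding y_def using K(2) by (intro ell2_sum ell2_basis_in) auto
  have b: "bounded_operator I (S i)" if "i \<in> verts G" for i
    using rep that unfolding self_adjoint_unitary_rep_def self_adjoint_def by blast
  note trunc = density_kernel_sum_truncated[OF \<psi> K(2) _ y_def]
  have "(\<Sum>j\<in>K. \<Sum>k\<in>K. density_kernel I \<rho> k j * ell2_basis k j) = (\<Sum>j\<in>K. density_kernel I \<rho> j j)"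
    using K(1) by (simp add: ell2_basis_def if_distrib cong: if_cong)
  then have "t = (\<Sum>l\<in>K. Re (ell2_inner I (y l) (y l)))"
    unfolding t(1) using trunc[OF _ _ bounded_operator_id] by (simp flip: Re_sum)
  from mixture_le_lovasz[OF fin w loop rep y this t(2)] show ?thesis
    using trunc[OF _ _ b] by (simp flip: Re_sum)
qed

text \<open>The bounds for truncations pass to the limit over finite \<open>K\<close>, since the
  expectations converge and the factor \<open>(t K)\<^sup>2\<close> tends to 1.\<close>

lemma unitary_rep_le_lovasz:
  fixes w :: "'v \<Rightarrow> real"
  assumes fin: "finite (verts G)" and w: "\<forall>i\<in>verts G. 0 \<le> w i" and loop: "\<And>i. {i} \<notin> edges G"
    and rep: "self_adjoint_unitary_rep G I S" and \<rho>: "density_operator I \<rho>"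
  shows "(\<Sum>i\<in>verts G. w i * (expectation I \<rho> (S i))\<^sup>2) \<le> weighted_lovasz G w"
proof -
  \<comment> \<open>Outside \<open>J\<close> the expectation is the junk value \<open>0\<close> of a divergent sum. This does not occur for
    trace class \<open>\<rho>\<close>, but dropping these terms avoids proving so.\<close>
  define J where "J = {i \<in> verts G. (\<lambda>k. ell2_inner I (ell2_basis k) (\<rho> (S i (ell2_basis k)))) summable_on I}"
  have J: "J \<subseteq> verts G" by (auto simp: J_def)
  define f where "f i K = Re (\<Sum>j\<in>K. \<Sum>k\<in>K. density_kernel I \<rho> k j * S i (ell2_basis k) j)" for i K
  define t where "t K = (\<Sum>k\<in>K. Re (density_kernel I \<rho> k k))" for K
  have sa: "self_adjoint I (S i)" and inv: "\<And>x. x \<in> ell2 I \<Longrightarrow> S i (S i x) = x" if "i \<in> verts G" for i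
    using rep that unfolding self_adjoint_unitary_rep_def by auto
  have zero: "expectation I \<rho> (S i) = 0" if "i \<in> verts G - J" for i
    using that by (auto simp: J_def expectation_def infsum_not_exists)
  have "(\<Sum>i\<in>verts G. w i * (expectation I \<rho> (S i))\<^sup>2) = (\<Sum>i\<in>J. w i * (expectation I \<rho> (S i))\<^sup>2)"
    using fin J zero by (intro sum.mono_neutral_right) auto
  also have "\<dots> \<le> 1\<^sup>2 * weighted_lovasz G w"
  proof (rule tendsto_le)
    show "((\<lambda>K. \<Sum>i\<in>J. w i * (f i K)\<^sup>2) \<longlongrightarrow> (\<Sum>i\<in>J. w i * (expectation I \<rho> (S i))\<^sup>2)) (finite_subsets_at_top I)"
      unfolding f_def using J sa inv
      by (intro tendsto_intros truncation_tendsto[OF \<rho>]) (auto simp: J_def)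
    have t: "(t \<longlongrightarrow> 1) (finite_subsets_at_top I)"
      using density_kernel_trace[OF \<rho>] by (simp add: has_sum_def t_def[abs_def])
    then show "((\<lambda>K. (t K)\<^sup>2 * weighted_lovasz G w) \<longlongrightarrow> 1\<^sup>2 * weighted_lovasz G w) (finite_subsets_at_top I)"
      by (intro tendsto_intros)
    \<comment> \<open>Normalising a truncation needs positive trace, which fails for empty
      \<open>K\<close> but holds eventually.\<close>
    have "\<forall>\<^sub>F K in finite_subsets_at_top I. 0 < t K"
      using order_tendstoD(1)[OF t, of 0] by simp
    moreover have "\<forall>\<^sub>F K in finite_subsets_at_top I. finite K \<and> K \<subseteq> I"
      by (intro eventually_finite_subsets_at_top_weakI) auto
    ultimately show "\<forall>\<^sub>F K in finite_subsets_at_top I. (\<Sum>i\<in>J. w i * (f i K)\<^sup>2) \<le> (t K)\<^sup>2 * weighted_lovasz G w"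
    proof eventually_elim
      case (elim K)
      have "(\<Sum>i\<in>J. w i * (f i K)\<^sup>2) \<le> (\<Sum>i\<in>verts G. w i * (f i K)\<^sup>2)"
        using fin J w by (intro sum_mono2) auto
      also have "\<dots> \<le> (t K)\<^sup>2 * weighted_lovasz G w"
        unfolding f_def using elim by (intro truncation_le_lovasz[OF fin w loop rep \<rho>]) (auto simp: t_def)
      finally show ?case .
    qed
  qed simp
  finally show ?thesis by simp
qed

section \<open>Matrices as operators\<close>

text \<open>Since \<open>weighted_beta\<close> only sees index sets inside a given type, coordinates
  are placed there by an injection \<open>e\<close>. The value 0 off its image keeps results in
  \<open>ell2\<close>.\<close>

definition matrix_operator :: "nat \<Rightarrow> (nat \<Rightarrow> 'u) \<Rightarrow> complex mat \<Rightarrow> 'u operator" where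
  "matrix_operator d e M x = (\<lambda>u. if u \<in> e ` {..<d}
     then \<Sum>k<d. M $$ (the_inv_into {..<d} e u, k) * x (e k) else 0)"

lemma matrix_operator_apply:
  "inj_on e {..<d} \<Longrightarrow> j < d \<Longrightarrow> matrix_operator d e M x (e j) = (\<Sum>k<d. M $$ (j, k) * x (e k))"
  by (simp add: matrix_operator_def the_inv_into_f_f)

lemma matrix_operator_in_ell2: "matrix_operator d e M x \<in> ell2 (e ` {..<d})"
  by (subst ell2_finite) (auto simp: matrix_operator_def)

lemma ell2_image_eqI:
  "x \<in> ell2 (e ` {..<d::nat}) \<Longrightarrow> y \<in> ell2 (e ` {..<d}) \<Longrightarrow> (\<And>k. k < d \<Longrightarrow> x (e k) = y (e k)) \<Longrightarrow> x = y"
  by (rule ell2_eqI) auto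

lemma ell2_inner_image:
  "inj_on e {..<d::nat} \<Longrightarrow> ell2_inner (e ` {..<d}) x y = (\<Sum>k<d. cnj (x (e k)) * y (e k))"
  by (simp add: ell2_inner_def sum.reindex)

lemma ell2_norm_image:
  "inj_on e {..<d::nat} \<Longrightarrow> ell2_norm (e ` {..<d}) x = L2_set (\<lambda>k. cmod (x (e k))) {..<d}"
  by (simp add: ell2_norm_def L2_set_def sum.reindex)

lemma matrix_operator_mult:
  assumes "inj_on e {..<d}" "A \<in> carrier_mat d d" "B \<in> carrier_mat d d"
  shows "matrix_operator d e A (matrix_operator d e B x) = matrix_operator d e (A * B) x"
proof (rule ell2_image_eqI)
  fix j assume j: "j < d"
  have AB: "(A * B) $$ (j, k) = (\<Sum>l<d. A $$ (j, l) * B $$ (l, k))" if "k < d" for k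
    using assms j that by (auto simp: scalar_prod_def atLeast0LessThan intro!: sum.cong)
  have "matrix_operator d e A (matrix_operator d e B x) (e j)
      = (\<Sum>l<d. \<Sum>k<d. A $$ (j, l) * B $$ (l, k) * x (e k))"
    using assms(1) j by (simp add: matrix_operator_apply sum_distrib_left mult.assoc)
  also have "\<dots> = (\<Sum>k<d. \<Sum>l<d. A $$ (j, l) * B $$ (l, k) * x (e k))" by (rule sum.swap)
  also have "\<dots> = matrix_operator d e (A * B) x (e j)"
    using assms(1) j by (simp add: matrix_operator_apply AB sum_distrib_right)
  finally show "matrix_operator d e A (matrix_operator d e B x) (e j)
    = matrix_operator d e (A * B) x (e j)" .
qed (rule matrix_operator_in_ell2)+

lemma matrix_operator_one:
  assumes "inj_on e {..<d}" "x \<in> ell2 (e ` {..<d})"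
  shows "matrix_operator d e (1\<^sub>m d) x = x"
proof (rule ell2_image_eqI[OF matrix_operator_in_ell2 assms(2)])
  fix j assume j: "j < d"
  have "(\<Sum>k<d. 1\<^sub>m d $$ (j, k) * x (e k)) = (\<Sum>k<d. if k = j then x (e k) else 0)"
    using j by (intro sum.cong) auto
  then show "matrix_operator d e (1\<^sub>m d) x (e j) = x (e j)"
    using assms(1) j by (simp add: matrix_operator_apply)
qed

lemma matrix_operator_uminus:
  assumes "inj_on e {..<d}" "A \<in> carrier_mat d d"
  shows "matrix_operator d e (- A) x = (\<lambda>u. - matrix_operator d e A x u)"
proof
  fix u
  show "matrix_operator d e (- A) x u = - matrix_operator d e A x u"
  proof (cases "u \<in> e ` {..<d}")
    case True
    then obtain j where "j < d" "u = e j" by auto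
    then show ?thesis
      using assms by (simp add: matrix_operator_apply sum_negf[symmetric])
  qed (simp add: matrix_operator_def)
qed

lemma matrix_operator_basis:
  assumes "inj_on e {..<d}" "j < d" "k < d"
  shows "matrix_operator d e M (ell2_basis (e k)) (e j) = M $$ (j, k)"
proof -
  have "(\<Sum>l<d. M $$ (j, l) * ell2_basis (e k) (e l)) = (\<Sum>l<d. if l = k then M $$ (j, l) else 0)"
    using assms by (intro sum.cong) (auto simp: ell2_basis_def inj_on_def)
  then show ?thesis using assms by (simp add: matrix_operator_apply)
qed

lemma matrix_operator_bounded:
  assumes e: "inj_on e {..<d}"
  shows "bounded_operator (e ` {..<d}) (matrix_operator d e M)"
  unfolding bounded_operator_def
proof (intro conjI ballI allI)
  let ?T = "matrix_operator d e M"
  show "?T x \<in> ell2 (e ` {..<d})" for x by (rule matrix_operator_in_ell2)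
  show "?T (\<lambda>i. x i + y i) = (\<lambda>i. ?T x i + ?T y i)" for x y
    by (auto simp: matrix_operator_def distrib_left sum.distrib)
  show "?T (\<lambda>i. c * x i) = (\<lambda>i. c * ?T x i)" for c x
    by (auto simp: matrix_operator_def sum_distrib_left mult_ac)
  show "\<exists>B. \<forall>x\<in>ell2 (e ` {..<d}). ell2_norm (e ` {..<d}) (?T x) \<le> B * ell2_norm (e ` {..<d}) x"
  proof (intro exI ballI)
    fix x :: "'a \<Rightarrow> complex"
    let ?n = "ell2_norm (e ` {..<d}) x"
    have x: "cmod (x (e k)) \<le> ?n" if "k < d" for k
      using that member_le_L2_set[of "{..<d}" k "\<lambda>k. cmod (x (e k))"] by (simp add: ell2_norm_image[OF e])
    have "ell2_norm (e ` {..<d}) (?T x) \<le> (\<Sum>j<d. cmod (?T x (e j)))"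
      unfolding ell2_norm_image[OF e] by (rule L2_set_le_sum) simp
    also have "\<dots> \<le> (\<Sum>j<d. \<Sum>k<d. cmod (M $$ (j, k)) * ?n)"
    proof (rule sum_mono)
      fix j assume "j \<in> {..<d}"
      then show "cmod (?T x (e j)) \<le> (\<Sum>k<d. cmod (M $$ (j, k)) * ?n)"
        using x by (auto simp: matrix_operator_apply[OF e] norm_mult intro!: sum_norm_le mult_left_mono)
    qed
    finally show "ell2_norm (e ` {..<d}) (?T x) \<le> (\<Sum>j<d. \<Sum>k<d. cmod (M $$ (j, k))) * ?n"
      by (simp add: sum_distrib_right)
  qed
qed

lemma matrix_operator_self_adjoint:
  assumes e: "inj_on e {..<d}" and M: "\<And>j k. j < d \<Longrightarrow> k < d \<Longrightarrow> M $$ (k, j) = cnj (M $$ (j, k))"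
  shows "self_adjoint (e ` {..<d}) (matrix_operator d e M)"
  unfolding self_adjoint_def
proof (intro conjI ballI matrix_operator_bounded[OF e])
  fix x y :: "'a \<Rightarrow> complex"
  let ?T = "matrix_operator d e M"
  have "ell2_inner (e ` {..<d}) (?T x) y = (\<Sum>j<d. \<Sum>k<d. cnj (M $$ (j, k)) * (cnj (x (e k)) * y (e j)))"
    by (simp add: ell2_inner_image[OF e] matrix_operator_apply[OF e] sum_distrib_right mult.assoc)
  also have "\<dots> = (\<Sum>k<d. \<Sum>j<d. cnj (M $$ (j, k)) * (cnj (x (e k)) * y (e j)))" by (rule sum.swap)
  also have "\<dots> = (\<Sum>k<d. \<Sum>j<d. cnj (x (e k)) * (M $$ (k, j) * y (e j)))"
  proof (intro sum.cong refl)
    fix j k assume "k \<in> {..<d}" "j \<in> {..<d}"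
    then show "cnj (M $$ (j, k)) * (cnj (x (e k)) * y (e j)) = cnj (x (e k)) * (M $$ (k, j) * y (e j))"
      using M[of j k] by (simp add: mult_ac)
  qed
  also have "\<dots> = ell2_inner (e ` {..<d}) x (?T y)"
    by (simp add: ell2_inner_image[OF e] matrix_operator_apply[OF e] sum_distrib_left)
  finally show "ell2_inner (e ` {..<d}) (?T x) y = ell2_inner (e ` {..<d}) x (?T y)" .
qed

lemma matrix_operator_density:
  assumes e: "inj_on e {..<d}" and \<rho>: "density_matrix d \<rho>"
  shows "density_operator (e ` {..<d}) (matrix_operator d e \<rho>)"
  unfolding density_operator_def
proof (intro conjI ballI matrix_operator_bounded[OF e])
  let ?T = "matrix_operator d e \<rho>"
  have c: "\<rho> \<in> carrier_mat d d" and tr: "mat_trace \<rho> = 1"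
    and pos: "\<And>v. v \<in> carrier_vec d \<Longrightarrow> nonneg_complex ((\<rho> *\<^sub>v v) \<bullet>c v)"
    using \<rho> by (auto simp: density_matrix_def)
  show "nonneg_complex (ell2_inner (e ` {..<d}) x (?T x))" for x
  proof -
    let ?v = "vec d (\<lambda>k. x (e k))"
    \<comment> \<open>\<open>\<bullet>c\<close> conjugates its second argument,
      \<open>ell2_inner\<close> its first, hence the swapped order.\<close>
    have "(\<rho> *\<^sub>v ?v) \<bullet>c ?v = ell2_inner (e ` {..<d}) x (?T x)"
      using c by (auto simp: ell2_inner_image[OF e] matrix_operator_apply[OF e] scalar_prod_def
          atLeast0LessThan mult.commute intro!: sum.cong)
    then show ?thesis using pos[of ?v] by simp
  qed
  have "(\<Sum>k<d. ell2_inner (e ` {..<d}) (ell2_basis (e k)) (?T (ell2_basis (e k)))) = 1"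
    using tr c by (simp add: ell2_inner_basis_left matrix_operator_basis[OF e] mat_trace_def)
  then show "((\<lambda>i. ell2_inner (e ` {..<d}) (ell2_basis i) (?T (ell2_basis i))) has_sum 1) (e ` {..<d})"
    by (simp add: has_sum_finite_iff sum.reindex[OF e])
qed

lemma matrix_operator_expectation:
  assumes e: "inj_on e {..<d}" and c: "\<rho> \<in> carrier_mat d d" "A \<in> carrier_mat d d"
  shows "expectation (e ` {..<d}) (matrix_operator d e \<rho>) (matrix_operator d e A) = mat_expectation \<rho> A"
  using c by (simp add: expectation_def mat_expectation_def mat_trace_def sum.reindex[OF e]
      matrix_operator_mult[OF e c] ell2_inner_basis_left matrix_operator_basis[OF e])

section \<open>Pauli strings\<close>

text \<open>Matches the \<open>div\<close> and \<open>mod\<close> indexing of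
  \<open>kronecker\<close>, so that the contracted index of a product splits in two.\<close>

lemma sum_lessThan_mult:
  fixes f :: "nat \<Rightarrow> 'a::comm_monoid_add"
  shows "(\<Sum>k<a * b. f k) = (\<Sum>i<a. \<Sum>j<b. f (i * b + j))"
proof -
  have "(\<Sum>j<b. f (i * b + j)) = sum f {i * b..<i * b + b}" for i
    using sum.shift_bounds_nat_ivl[of f 0 "i * b" b] by (simp add: atLeast0LessThan add.commute)
  then show ?thesis by (simp add: sum.nat_group)
qed

lemma kronecker_carrier:
  "A \<in> carrier_mat p q \<Longrightarrow> B \<in> carrier_mat r s \<Longrightarrow> kronecker A B \<in> carrier_mat (p * r) (q * s)"
  by (auto simp: kronecker_def)

lemma kronecker_index:
  "A \<in> carrier_mat p q \<Longrightarrow> B \<in> carrier_mat r s \<Longrightarrow> i < p * r \<Longrightarrow> j < q * s \<Longrightarrow>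
    kronecker A B $$ (i, j) = A $$ (i div r, j div s) * B $$ (i mod r, j mod s)"
  by (auto simp: kronecker_def)

text \<open>The mixed-product rule. Commutativity of the entries is what lets those of
  \<open>B\<close> and \<open>C\<close> change places.\<close>

lemma kronecker_mult:
  fixes A :: "'a::comm_semiring_1 mat"
  assumes "A \<in> carrier_mat p q" "B \<in> carrier_mat r s" "C \<in> carrier_mat q u" "D \<in> carrier_mat s v"
  shows "kronecker A B * kronecker C D = kronecker (A * C) (B * D)"
proof (rule eq_matI)
  have AC: "A * C \<in> carrier_mat p u" and BD: "B * D \<in> carrier_mat r v" using assms by auto
  note c = kronecker_carrier[OF assms(1,2)] kronecker_carrier[OF assms(3,4)] kronecker_carrier[OF AC BD]
  show "dim_row (kronecker A B * kronecker C D) = dim_row (kronecker (A * C) (B * D))"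
    "dim_col (kronecker A B * kronecker C D) = dim_col (kronecker (A * C) (B * D))"
    using c by auto
  fix i j assume "i < dim_row (kronecker (A * C) (B * D))" "j < dim_col (kronecker (A * C) (B * D))"
  then have i: "i < p * r" and j: "j < u * v" using c by auto
  \<comment> \<open>\<open>i < p * r\<close> and \<open>j < u * v\<close> force \<open>r\<close> and
    \<open>v\<close> to be positive, as the bounds on \<open>mod\<close> require.\<close>
  have d: "i div r < p" "i mod r < r" "j div v < u" "j mod v < v"
    using i j by (auto simp: less_mult_imp_div_less intro!: mod_less_divisor gr0I)
  have "(kronecker A B * kronecker C D) $$ (i, j)
      = (\<Sum>k<q * s. kronecker A B $$ (i, k) * kronecker C D $$ (k, j))"
    using c i j by (auto simp: scalar_prod_def atLeast0LessThan intro!: sum.cong)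
  also have "\<dots> = (\<Sum>k<q. \<Sum>l<s. (A $$ (i div r, k) * C $$ (k, j div v)) * (B $$ (i mod r, l) * D $$ (l, j mod v)))"
    unfolding sum_lessThan_mult
  proof (intro sum.cong refl)
    fix k l assume "k \<in> {..<q}" "l \<in> {..<s}"
    then have "k * s + l < Suc k * s" "Suc k * s \<le> q * s"
      by (auto intro: mult_le_mono1 simp del: mult_Suc) simp
    then have "k * s + l < q * s" by (rule less_le_trans)
    moreover have "(k * s + l) div s = k" "(k * s + l) mod s = l"
      using \<open>l \<in> {..<s}\<close> by auto
    ultimately
    show "kronecker A B $$ (i, k * s + l) * kronecker C D $$ (k * s + l, j)
        = (A $$ (i div r, k) * C $$ (k, j div v)) * (B $$ (i mod r, l) * D $$ (l, j mod v))"
      using i j by (simp add: kronecker_index[OF assms(1,2)] kronecker_index[OF assms(3,4)] mult_ac)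
  qed
  also have "\<dots> = (\<Sum>k<q. A $$ (i div r, k) * C $$ (k, j div v)) * (\<Sum>l<s. B $$ (i mod r, l) * D $$ (l, j mod v))"
    by (simp add: sum_product)
  also have "\<dots> = (A * C) $$ (i div r, j div v) * (B * D) $$ (i mod r, j mod v)"
    using assms d by (auto simp: scalar_prod_def atLeast0LessThan intro!: sum.cong arg_cong2[where f="(*)"])
  also have "\<dots> = kronecker (A * C) (B * D) $$ (i, j)"
    using i j by (simp add: kronecker_index[OF AC BD])
  finally show "(kronecker A B * kronecker C D) $$ (i, j) = kronecker (A * C) (B * D) $$ (i, j)" .
qed

lemma kronecker_one: "kronecker (1\<^sub>m p) (1\<^sub>m q) = (1\<^sub>m (p * q) :: 'a::semiring_1 mat)"
proof (rule eq_matI)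
  fix i j assume "i < dim_row (1\<^sub>m (p * q))" "j < dim_col (1\<^sub>m (p * q))"
  then have ij: "i < p * q" "j < p * q" by auto
  have "i div q < p" "j div q < p" "i mod q < q" "j mod q < q"
    using ij by (auto simp: less_mult_imp_div_less intro!: mod_less_divisor gr0I)
  moreover have "i div q = j div q \<and> i mod q = j mod q \<longleftrightarrow> i = j" by (metis div_mult_mod_eq)
  ultimately show "kronecker (1\<^sub>m p) (1\<^sub>m q) $$ (i, j) = (1\<^sub>m (p * q) :: 'a mat) $$ (i, j)"
    using ij by (auto simp: kronecker_def)
qed (auto simp: kronecker_def)

lemma kronecker_uminus_left: "kronecker (- A) B = - kronecker (A :: 'a::ring_1 mat) B"
proof (rule eq_matI)
  fix i j assume "i < dim_row (- kronecker A B)" "j < dim_col (- kronecker A B)"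
  then have "i < dim_row A * dim_row B" "j < dim_col A * dim_col B" by (auto simp: kronecker_def)
  then show "kronecker (- A) B $$ (i, j) = (- kronecker A B) $$ (i, j)"
    by (simp add: kronecker_def less_mult_imp_div_less)
qed (auto simp: kronecker_def)

lemma kronecker_uminus_right: "kronecker A (- B) = - kronecker (A :: 'a::ring_1 mat) B"
proof (rule eq_matI)
  fix i j assume "i < dim_row (- kronecker A B)" "j < dim_col (- kronecker A B)"
  then have ij: "i < dim_row A * dim_row B" "j < dim_col A * dim_col B" by (auto simp: kronecker_def)
  then have "i mod dim_row B < dim_row B" "j mod dim_col B < dim_col B"
    by (auto intro!: mod_less_divisor gr0I)
  then show "kronecker A (- B) $$ (i, j) = (- kronecker A B) $$ (i, j)"
    using ij by (simp add: kronecker_def)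
qed (auto simp: kronecker_def)

text \<open>What a representation demands of a single generator, in a form stable under
  \<open>kronecker\<close>, so that induction over the tensor factors applies.\<close>

definition hermitian_involution :: "nat \<Rightarrow> complex mat \<Rightarrow> bool" where
  "hermitian_involution d M \<longleftrightarrow> M \<in> carrier_mat d d \<and> M * M = 1\<^sub>m d \<and>
     (\<forall>j<d. \<forall>k<d. M $$ (k, j) = cnj (M $$ (j, k)))"

lemma hermitian_involution_kronecker:
  assumes "hermitian_involution p A" "hermitian_involution q B"
  shows "hermitian_involution (p * q) (kronecker A B)"
  unfolding hermitian_involution_def
proof (intro conjI allI impI)
  have A: "A \<in> carrier_mat p p" "A * A = 1\<^sub>m p" "\<And>j k. j < p \<Longrightarrow> k < p \<Longrightarrow> A $$ (k, j) = cnj (A $$ (j, k))"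
    and B: "B \<in> carrier_mat q q" "B * B = 1\<^sub>m q" "\<And>j k. j < q \<Longrightarrow> k < q \<Longrightarrow> B $$ (k, j) = cnj (B $$ (j, k))"
    using assms unfolding hermitian_involution_def by blast+
  show "kronecker A B \<in> carrier_mat (p * q) (p * q)" using A B by (intro kronecker_carrier)
  show "kronecker A B * kronecker A B = 1\<^sub>m (p * q)"
    by (simp add: kronecker_mult[OF A(1) B(1) A(1) B(1)] A B kronecker_one)
  fix j k assume jk: "j < p * q" "k < p * q"
  then have "j div q < p" "k div q < p" "j mod q < q" "k mod q < q"
    by (auto simp: less_mult_imp_div_less intro!: mod_less_divisor gr0I)
  with jk show "kronecker A B $$ (k, j) = cnj (kronecker A B $$ (j, k))"
    by (simp add: kronecker_index[OF A(1) B(1)] A(3)[of "j div q" "k div q"] B(3)[of "j mod q" "k mod q"])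
qed

lemma carrier_mat_2_eqI:
  "A \<in> carrier_mat 2 2 \<Longrightarrow> B \<in> carrier_mat 2 2 \<Longrightarrow> A $$ (0, 0) = B $$ (0, 0) \<Longrightarrow> A $$ (0, 1) = B $$ (0, 1) \<Longrightarrow>
    A $$ (1, 0) = B $$ (1, 0) \<Longrightarrow> A $$ (1, 1) = B $$ (1, 1) \<Longrightarrow> A = B"
  by (rule eq_matI) (auto simp: less_2_cases_iff)

abbreviation paulis :: "complex mat set" where
  "paulis \<equiv> {1\<^sub>m 2, pauli_X, pauli_Y, pauli_Z}"

lemma pauli_carrier: "P \<in> paulis \<Longrightarrow> P \<in> carrier_mat 2 2"
  by (auto simp: pauli_X_def pauli_Y_def pauli_Z_def mat_of_rows_list_def)

lemma pauli_entries:
  "pauli_X $$ (0, 0) = 0" "pauli_X $$ (0, Suc 0) = 1" "pauli_X $$ (Suc 0, 0) = 1" "pauli_X $$ (Suc 0, Suc 0) = 0"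
  "pauli_Y $$ (0, 0) = 0" "pauli_Y $$ (0, Suc 0) = - \<i>" "pauli_Y $$ (Suc 0, 0) = \<i>" "pauli_Y $$ (Suc 0, Suc 0) = 0"
  "pauli_Z $$ (0, 0) = 1" "pauli_Z $$ (0, Suc 0) = 0" "pauli_Z $$ (Suc 0, 0) = 0" "pauli_Z $$ (Suc 0, Suc 0) = - 1"
  by (auto simp: pauli_X_def pauli_Y_def pauli_Z_def mat_of_rows_list_def)

lemma mult_2_index:
  "A \<in> carrier_mat 2 2 \<Longrightarrow> B \<in> carrier_mat 2 2 \<Longrightarrow> i < 2 \<Longrightarrow> j < 2 \<Longrightarrow>
    (A * B) $$ (i, j) = A $$ (i, 0) * B $$ (0, j) + A $$ (i, Suc 0) * B $$ (Suc 0, j)"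
  by (auto simp: scalar_prod_def numeral_2_eq_2)

lemma pauli_hermitian_involution:
  assumes "P \<in> paulis"
  shows "hermitian_involution 2 P"
proof -
  have c: "P \<in> carrier_mat 2 2" using assms by (rule pauli_carrier)
  have "P * P = 1\<^sub>m 2"
    by (rule carrier_mat_2_eqI) (use assms c in \<open>auto simp: mult_2_index pauli_entries simp del: index_mult_mat(1)\<close>)
  with c show ?thesis
    using assms by (auto simp: hermitian_involution_def less_2_cases_iff pauli_entries)
qed

lemma pauli_commute_or_anticommute:
  assumes "P \<in> paulis" "Q \<in> paulis"
  shows "P * Q = Q * P \<or> P * Q = - (Q * P)"
proof -
  have c: "P \<in> carrier_mat 2 2" "Q \<in> carrier_mat 2 2" using assms by (auto intro: pauli_carrier)
  have "P * Q = Q * P" if "P = Q \<or> P = 1\<^sub>m 2 \<or> Q = 1\<^sub>m 2"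
    using that c by auto
  moreover have "P * Q = - (Q * P)" if "\<not> (P = Q \<or> P = 1\<^sub>m 2 \<or> Q = 1\<^sub>m 2)"
  proof (rule carrier_mat_2_eqI)
  qed (use assms c that in \<open>auto simp: mult_2_index pauli_entries simp del: index_mult_mat(1)\<close>)
  ultimately show ?thesis by blast
qed

lemma foldr_kronecker_hermitian_involution:
  "set Ps \<subseteq> paulis \<Longrightarrow> hermitian_involution (2 ^ length Ps) (foldr kronecker Ps (1\<^sub>m 1))"
proof (induction Ps)
  case Nil
  then show ?case by (simp add: hermitian_involution_def)
next
  case (Cons P Ps)
  then show ?case
    using hermitian_involution_kronecker[OF pauli_hermitian_involution[of P] Cons.IH] by simp
qed

lemma pauli_string_hermitian_involution: "pauli_string m M \<Longrightarrow> hermitian_involution (2 ^ m) M"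
  using foldr_kronecker_hermitian_involution unfolding pauli_string_def by blast

lemma uminus_uminus_complex_mat: "- (- A) = (A :: complex mat)"
  by (rule eq_matI) auto

text \<open>Exchanging two strings yields one sign per tensor factor, and the signs
  multiply.\<close>

lemma foldr_kronecker_commute_or_anticommute:
  fixes Ps Qs :: "complex mat list"
  assumes "length Ps = length Qs" "set Ps \<subseteq> paulis" "set Qs \<subseteq> paulis"
  defines "M \<equiv> foldr kronecker Ps (1\<^sub>m 1)" and "N \<equiv> foldr kronecker Qs (1\<^sub>m 1)"
  shows "M * N = N * M \<or> M * N = - (N * M)"
  using assms(1-3) unfolding M_def N_def
proof (induction Ps Qs rule: list_induct2)
  case Nil
  then show ?case by simp
next
  case (Cons P Ps Q Qs)
  let ?M = "foldr kronecker Ps (1\<^sub>m 1)" and ?N = "foldr kronecker Qs (1\<^sub>m 1)"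
  have PQ: "P \<in> carrier_mat 2 2" "Q \<in> carrier_mat 2 2" using Cons.prems by (auto intro: pauli_carrier)
  have MN: "?M \<in> carrier_mat (2 ^ length Qs) (2 ^ length Qs)" "?N \<in> carrier_mat (2 ^ length Qs) (2 ^ length Qs)"
    using foldr_kronecker_hermitian_involution[of Ps] foldr_kronecker_hermitian_involution[of Qs] Cons
    unfolding hermitian_involution_def by auto
  have "P * Q = Q * P \<or> P * Q = - (Q * P)"
    using Cons.prems by (intro pauli_commute_or_anticommute) auto
  moreover have "?M * ?N = ?N * ?M \<or> ?M * ?N = - (?N * ?M)" using Cons by auto
  ultimately show ?case
    by (auto simp: kronecker_mult[OF PQ(1) MN(1) PQ(2) MN(2)] kronecker_mult[OF PQ(2) MN(2) PQ(1) MN(1)]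
        kronecker_uminus_left kronecker_uminus_right uminus_uminus_complex_mat simp del: One_nat_def)
qed

lemma pauli_string_commute_or_anticommute:
  assumes "pauli_string m M" "pauli_string m N"
  shows "M * N = N * M \<or> M * N = - (N * M)"
  using assms foldr_kronecker_commute_or_anticommute unfolding pauli_string_def by metis

section \<open>Pauli strings as a representation of their frustration graph\<close>

lemma frustration_graph_edge_iff:
  assumes A: "\<And>i. i \<in> {1..n} \<Longrightarrow> A i \<in> carrier_mat d d" and ij: "i \<in> {1..n}" "j \<in> {1..n}" "i \<noteq> j"
  shows "{i, j} \<in> edges (frustration_graph n A) \<longleftrightarrow> A i * A j = - (A j * A i)"
proof -
  \<comment> \<open>An unordered edge may stem from either order of its ends, so the relation has to
    be symmetric.\<close>
  have "A j * A i = - (A i * A j) \<longleftrightarrow> A i * A j = - (A j * A i)"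
    by (metis uminus_uminus_complex_mat)
  then show ?thesis using ij by (auto simp: frustration_graph_def doubleton_eq_iff)
qed

text \<open>A non-edge says only that two strings fail to anti-commute; the dichotomy for Pauli
  strings turns this into commutation.\<close>

lemma frustration_graph_rep:
  assumes e: "inj_on e {..<2 ^ m}" and A: "\<And>i. i \<in> {1..n} \<Longrightarrow> pauli_string m (A i)"
  shows "self_adjoint_unitary_rep (frustration_graph n A) (e ` {..<2 ^ m})
    (\<lambda>i. matrix_operator (2 ^ m) e (A i))"
proof -
  have h: "hermitian_involution (2 ^ m) (A i)" if "i \<in> {1..n}" for i
    using A[OF that] by (rule pauli_string_hermitian_involution)
  then have c: "A i \<in> carrier_mat (2 ^ m) (2 ^ m)" if "i \<in> {1..n}" for i
    using that unfolding hermitian_involution_def by blast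
  have v: "verts (frustration_graph n A) = {1..n}" by (simp add: frustration_graph_def)
  show ?thesis
    unfolding self_adjoint_unitary_rep_def v
  proof (intro conjI ballI impI)
    fix i assume i: "i \<in> {1..n}"
    show "self_adjoint (e ` {..<2 ^ m}) (matrix_operator (2 ^ m) e (A i))"
      using h[OF i] unfolding hermitian_involution_def by (intro matrix_operator_self_adjoint[OF e]) blast
    show "matrix_operator (2 ^ m) e (A i) (matrix_operator (2 ^ m) e (A i) x) = x"
      if "x \<in> ell2 (e ` {..<2 ^ m})" for x
    proof -
      have "A i * A i = 1\<^sub>m (2 ^ m)" using h[OF i] unfolding hermitian_involution_def by blast
      then show ?thesis
        using that by (simp add: matrix_operator_mult[OF e c[OF i] c[OF i]] matrix_operator_one[OF e])
    qed
  next
    fix i j assume ij: "i \<in> {1..n}" "j \<in> {1..n}" "i \<noteq> j"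
    have "A j * A i \<in> carrier_mat (2 ^ m) (2 ^ m)" using c[OF ij(1)] c[OF ij(2)] by (rule mult_carrier_mat[rotated])
    then show "if {i, j} \<in> edges (frustration_graph n A)
      then \<forall>x\<in>ell2 (e ` {..<2 ^ m}). matrix_operator (2 ^ m) e (A i) (matrix_operator (2 ^ m) e (A j) x)
        = (\<lambda>k. - matrix_operator (2 ^ m) e (A j) (matrix_operator (2 ^ m) e (A i) x) k)
      else \<forall>x\<in>ell2 (e ` {..<2 ^ m}). matrix_operator (2 ^ m) e (A i) (matrix_operator (2 ^ m) e (A j) x)
        = matrix_operator (2 ^ m) e (A j) (matrix_operator (2 ^ m) e (A i) x)"
      using frustration_graph_edge_iff[OF c ij] pauli_string_commute_or_anticommute[OF A[OF ij(1)] A[OF ij(2)]]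
      by (auto simp: matrix_operator_mult[OF e c[OF ij(1)] c[OF ij(2)]]
          matrix_operator_mult[OF e c[OF ij(2)] c[OF ij(1)]] matrix_operator_uminus[OF e])
  qed
qed

text \<open>Each product is split as \<open>(a i / sqrt (w i)) * (sqrt (w i) * x i)\<close>.\<close>

lemma weighted_Cauchy_Schwarz:
  fixes a x w :: "'i \<Rightarrow> real"
  assumes "\<And>i. i \<in> V \<Longrightarrow> 0 < w i"
  shows "(\<Sum>i\<in>V. a i * x i)\<^sup>2 \<le> (\<Sum>i\<in>V. (a i)\<^sup>2 / w i) * (\<Sum>i\<in>V. w i * (x i)\<^sup>2)"
proof -
  have "(\<Sum>i\<in>V. a i * x i) = (\<Sum>i\<in>V. (a i / sqrt (w i)) * (sqrt (w i) * x i))"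
    using assms by (intro sum.cong) (auto simp: less_le)
  then have "(\<Sum>i\<in>V. a i * x i)\<^sup>2 \<le> (\<Sum>i\<in>V. (a i / sqrt (w i))\<^sup>2) * (\<Sum>i\<in>V. (sqrt (w i) * x i)\<^sup>2)"
    by (simp only: Cauchy_Schwarz_ineq_sum)
  also have "\<dots> = (\<Sum>i\<in>V. (a i)\<^sup>2 / w i) * (\<Sum>i\<in>V. w i * (x i)\<^sup>2)"
    using assms by (intro arg_cong2[where f = "(*)"] sum.cong refl) (auto simp: power_divide power_mult_distrib less_imp_le)
  finally show ?thesis .
qed

theorem theorem26:
  fixes n m :: nat
    and A :: "nat \<Rightarrow> complex mat"
    and G :: "nat ugraph"
    and \<rho> :: "complex mat"
    and a :: "nat \<Rightarrow> real"
  assumes "\<forall>i\<in>{1..n}. pauli_string m (A i)"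
    and "G = frustration_graph n A"
    and "density_matrix (2 ^ m) \<rho>"
  shows "(\<Sum>i=1..n. a i * mat_expectation \<rho> (A i))\<^sup>2
           \<le> (INF w\<in>{w :: nat \<Rightarrow> real. \<forall>i\<in>{1..n}. 0 < w i}.
                (\<Sum>i=1..n. (a i)\<^sup>2 / w i) * weighted_beta TYPE('u::infinite) G w)
         \<and> (INF w\<in>{w :: nat \<Rightarrow> real. \<forall>i\<in>{1..n}. 0 < w i}.
                (\<Sum>i=1..n. (a i)\<^sup>2 / w i) * weighted_beta TYPE('u) G w)
           \<le> (INF w\<in>{w :: nat \<Rightarrow> real. \<forall>i\<in>{1..n}. 0 < w i}.
                (\<Sum>i=1..n. (a i)\<^sup>2 / w i) * weighted_lovasz G w)"
proof -
  let ?W = "{w :: nat \<Rightarrow> real. \<forall>i\<in>{1..n}. 0 < w i}"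
  have verts: "verts G = {1..n}" and loop: "\<And>i. {i} \<notin> edges G"
    by (auto simp: assms(2) frustration_graph_def doubleton_eq_iff)
  \<comment> \<open>As \<open>'u\<close> is infinite, it has room for the \<open>2 ^ m\<close>
    coordinates of the qubits.\<close>
  obtain e :: "nat \<Rightarrow> 'u" where "inj e" using infinite_countable_subset[OF infinite_UNIV] by blast
  then have e: "inj_on e {..<2 ^ m}" by (rule inj_on_subset) simp
  let ?I = "e ` {..<2 ^ m}" and ?S = "\<lambda>i. matrix_operator (2 ^ m) e (A i)"
  have rep: "self_adjoint_unitary_rep G ?I ?S"
    unfolding assms(2) using assms(1) by (intro frustration_graph_rep[OF e]) auto
  have dens: "density_operator ?I (matrix_operator (2 ^ m) e \<rho>)"
    by (rule matrix_operator_density[OF e assms(3)])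
  have ev: "expectation ?I (matrix_operator (2 ^ m) e \<rho>) (?S i) = mat_expectation \<rho> (A i)" if "i \<in> {1..n}" for i
    using assms(1,3) that pauli_string_hermitian_involution[of m "A i"]
    unfolding density_matrix_def hermitian_involution_def
    by (intro matrix_operator_expectation[OF e]) blast+
  have beta: "(\<Sum>i=1..n. w i * (mat_expectation \<rho> (A i))\<^sup>2) \<le> weighted_beta TYPE('u) G w"
    "weighted_beta TYPE('u) G w \<le> weighted_lovasz G w" if w: "w \<in> ?W" for w
  proof -
    let ?B = "{\<Sum>i\<in>verts G. w i * (expectation I \<sigma> (S i))\<^sup>2 | (I :: 'u set) S \<sigma>.
            self_adjoint_unitary_rep G I S \<and> density_operator I \<sigma>}"
    have "finite (verts G)" and "\<forall>i\<in>verts G. 0 \<le> w i" using w by (auto simp: verts less_imp_le)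
    \<comment> \<open>Used twice: it bounds the set, so that the value at the Pauli strings lies
      below the supremum, and it bounds the supremum itself. Nonemptiness comes from
      \<open>mem\<close>.\<close>
    then have up: "b \<le> weighted_lovasz G w" if "b \<in> ?B" for b
      using that unitary_rep_le_lovasz[OF _ _ loop] by blast
    have mem: "(\<Sum>i=1..n. w i * (mat_expectation \<rho> (A i))\<^sup>2) \<in> ?B"
      using rep dens ev by (auto simp: verts intro!: exI[of _ ?I] exI[of _ ?S] exI[of _ "matrix_operator (2 ^ m) e \<rho>"])
    show "(\<Sum>i=1..n. w i * (mat_expectation \<rho> (A i))\<^sup>2) \<le> weighted_beta TYPE('u) G w"
      unfolding weighted_beta_def using mem up by (intro cSup_upper bdd_aboveI) auto
    show "weighted_beta TYPE('u) G w \<le> weighted_lovasz G w"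
      unfolding weighted_beta_def using mem up by (intro cSup_least) auto
  qed
  have nonneg: "0 \<le> (\<Sum>i=1..n. (a i)\<^sup>2 / w i)" if "w \<in> ?W" for w
    using that by (intro sum_nonneg divide_nonneg_nonneg) (auto simp: less_imp_le)
  have lower: "(\<Sum>i=1..n. a i * mat_expectation \<rho> (A i))\<^sup>2
      \<le> (\<Sum>i=1..n. (a i)\<^sup>2 / w i) * weighted_beta TYPE('u) G w" if w: "w \<in> ?W" for w
    using weighted_Cauchy_Schwarz[of "{1..n}" w a "\<lambda>i. mat_expectation \<rho> (A i)"]
      mult_left_mono[OF beta(1)[OF w] nonneg[OF w]] w by force
  have ne: "?W \<noteq> {}" by (auto intro!: exI[of _ "\<lambda>_. 1"])
  show ?thesis
  proof
    show "(\<Sum>i=1..n. a i * mat_expectation \<rho> (A i))\<^sup>2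
        \<le> (INF w\<in>?W. (\<Sum>i=1..n. (a i)\<^sup>2 / w i) * weighted_beta TYPE('u) G w)"
      using ne lower by (rule cINF_greatest)
    show "(INF w\<in>?W. (\<Sum>i=1..n. (a i)\<^sup>2 / w i) * weighted_beta TYPE('u) G w)
        \<le> (INF w\<in>?W. (\<Sum>i=1..n. (a i)\<^sup>2 / w i) * weighted_lovasz G w)"
    proof (rule cINF_mono[OF ne])
      \<comment> \<open>The left inequality, valid for every \<open>w\<close>, provides the lower
        bound that comparing the infima requires.\<close>
      show "bdd_below ((\<lambda>w. (\<Sum>i=1..n. (a i)\<^sup>2 / w i) * weighted_beta TYPE('u) G w) ` ?W)"
        using lower by (intro bdd_belowI2) auto
    next
      fix w assume w: "w \<in> ?W"
      show "\<exists>w'\<in>?W. (\<Sum>i=1..n. (a i)\<^sup>2 / w' i) * weighted_beta TYPE('u) G w'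
          \<le> (\<Sum>i=1..n. (a i)\<^sup>2 / w i) * weighted_lovasz G w"
        using w mult_left_mono[OF beta(2)[OF w] nonneg[OF w]] by blast
    qed
  qed
qed

end
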